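(* Let $V \subset \mathbb{C}^n$ be an algebraic variety. Then the algebraic and geometric tangent cones of $V$ at infinity coincide: $C_{a,\infty}(V) = C_{g,\infty}(V)$.
   Context: An algebraic variety $V \subset \mathbb{C}^n$ is the common zero set of a set of polynomials in $\mathbb{C}[x_1,\ldots,x_n]$ (not necessarily irreducible). $\mathbf{I}(V)$ is the ideal of all polynomials in $\mathbb{C}[x_1,\ldots,x_n]$ vanishing on $V$. For a nonzero polynomial $f$, $f^*$ denotes its homogeneous component of highest degree (and $0^* := 0$). The geometric tangent cone of $V$ at infinity, $C_{g,\infty}(V) \subset \mathbb{C}^n$, is defined as follows: $v \in C_{g,\infty}(V)$ if and only if there exist a sequence $\{x_k\}_{k\in\mathbb{N}} \subset V$ with $\|x_k\| \to \infty$ and a sequence of numbers $\{t_k\}_{k\in\mathbb{N}} \subset \mathbb{C}$ such that $t_k x_k \to v$. In addition, by convention, $0 \in C_{g,\infty}(V)$ whenever $V \neq \emptyset$ (this matters only when $V$ is nonempty and bounded, i.e. finite, in which case $C_{g,\infty}(V) = \{0\}$). The algebraic tangent cone of $V$ at infinity is $C_{a,\infty}(V) := \{ v \in \mathbb{C}^n \mid f^*(v) = 0 \text{ for all } f \in \mathbf{I}(V) \}$. *)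

theory Defs
  imports "HOL-Analysis.Analysis" "HOL-Library.Poly_Mapping"
begin

text \<open>
  The ring \<open>\<complex>[x\<^sub>1, \<dots>, x\<^sub>n]\<close> is rendered as the type of finitely supported maps from monomials
  (exponent vectors \<open>'n \<Rightarrow>\<^sub>0 nat\<close>, with \<open>n = CARD('n)\<close>) to coefficients; its ring structure
  (convolution product) is the one of \<^theory>\<open>HOL-Library.Poly_Mapping\<close>.
\<close>

type_synonym 'n cpoly = "('n \<Rightarrow>\<^sub>0 nat) \<Rightarrow>\<^sub>0 complex"

definition monom_value :: "('n::finite \<Rightarrow>\<^sub>0 nat) \<Rightarrow> complex ^ 'n \<Rightarrow> complex" where
  "monom_value m x = (\<Prod>i\<in>UNIV. (x $ i) ^ Poly_Mapping.lookup m i)"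

definition poly_value :: "('n::finite) cpoly \<Rightarrow> complex ^ 'n \<Rightarrow> complex" where
  "poly_value f x = (\<Sum>m\<in>Poly_Mapping.keys f. Poly_Mapping.lookup f m * monom_value m x)"

definition monom_degree :: "('n::finite \<Rightarrow>\<^sub>0 nat) \<Rightarrow> nat" where
  "monom_degree m = (\<Sum>i\<in>UNIV. Poly_Mapping.lookup m i)"

text \<open>The zero polynomial gets the dummy degree 0.\<close>

definition total_degree :: "('n::finite) cpoly \<Rightarrow> nat" where
  "total_degree f = Max (insert 0 (monom_degree ` Poly_Mapping.keys f))"

definition hom_component :: "nat \<Rightarrow> ('n::finite) cpoly \<Rightarrow> 'n cpoly" where
  "hom_component d f = (\<Sum>m | m \<in> Poly_Mapping.keys f \<and> monom_degree m = d.
     Poly_Mapping.single m (Poly_Mapping.lookup f m))"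

definition top_form :: "('n::finite) cpoly \<Rightarrow> 'n cpoly" where
  "top_form f = hom_component (total_degree f) f"

definition algebraic_variety :: "(complex ^ 'n::finite) set \<Rightarrow> bool" where
  "algebraic_variety V \<longleftrightarrow> (\<exists>S :: 'n cpoly set. V = {x. \<forall>f\<in>S. poly_value f x = 0})"

definition vanishing_ideal :: "(complex ^ 'n::finite) set \<Rightarrow> 'n cpoly set" where
  "vanishing_ideal V = {f. \<forall>x\<in>V. poly_value f x = 0}"

text \<open>
  The second disjunct is the convention that 0 belongs to the geometric cone of every nonempty
  set; it only adds something when \<open>V\<close> is bounded.
\<close>

definition geometric_cone_at_infinity :: "(complex ^ 'n::finite) set \<Rightarrow> (complex ^ 'n) set" where
  "geometric_cone_at_infinity V =
     {v. (\<exists>(x :: nat \<Rightarrow> complex ^ 'n) (t :: nat \<Rightarrow> complex).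
            (\<forall>k. x k \<in> V) \<and> filterlim (\<lambda>k. norm (x k)) at_top sequentially \<and>
            (\<lambda>k. t k *s x k) \<longlonglongrightarrow> v)
         \<or> (V \<noteq> {} \<and> v = 0)}"

definition algebraic_cone_at_infinity :: "(complex ^ 'n::finite) set \<Rightarrow> (complex ^ 'n) set" where
  "algebraic_cone_at_infinity V = {v. \<forall>f\<in>vanishing_ideal V. poly_value (top_form f) v = 0}"

lemma lookup_hom_component:
  "Poly_Mapping.lookup (hom_component d f) m =
     (if monom_degree m = d then Poly_Mapping.lookup f m else 0)"
proof -
  have "Poly_Mapping.lookup (hom_component d f) m =
      (\<Sum>k | k \<in> Poly_Mapping.keys f \<and> monom_degree k = d.
         if k = m then Poly_Mapping.lookup f k else 0)"
    unfolding hom_component_def lookup_sum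
    by (intro sum.cong refl) (auto simp: lookup_single when_def)
  also have "\<dots> = (if monom_degree m = d then Poly_Mapping.lookup f m else 0)"
    by (subst sum.delta) (auto simp: in_keys_iff)
  finally show ?thesis .
qed

lemma top_form_zero [simp]: "top_form 0 = 0"
  by (simp add: top_form_def hom_component_def)

lemma top_form_nonzero: 
  assumes "f \<noteq> 0"
  shows "top_form f \<noteq> 0"
proof -
  have ne: "Poly_Mapping.keys f \<noteq> {}"
    using assms by (metis ex_in_conv in_keys_iff lookup_zero poly_mapping_eqI)
  hence "total_degree f = Max (monom_degree ` Poly_Mapping.keys f)"
    by (simp add: total_degree_def)
  hence "total_degree f \<in> monom_degree ` Poly_Mapping.keys f"
    using ne by (metis Max_in finite_imageI finite_keys image_is_empty)
  then obtain m where "m \<in> Poly_Mapping.keys f" "monom_degree m = total_degree f"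
    by auto
  hence "Poly_Mapping.lookup (top_form f) m \<noteq> 0"
    by (simp add: top_form_def lookup_hom_component in_keys_iff)
  thus ?thesis by auto
qed

lemma poly_value_superset:
  assumes "finite A" "Poly_Mapping.keys f \<subseteq> A"
  shows "poly_value f x = (\<Sum>m\<in>A. Poly_Mapping.lookup f m * monom_value m x)"
  unfolding poly_value_def by (intro sum.mono_neutral_left) (use assms in \<open>auto simp: in_keys_iff\<close>)

lemma poly_value_zero [simp]: "poly_value 0 x = 0"
  by (simp add: poly_value_def)

lemma poly_value_single: "poly_value (Poly_Mapping.single m c) x = c * monom_value m x"
  by (simp add: poly_value_def)

lemma poly_value_one [simp]: "poly_value 1 x = 1"
  using poly_value_single[of 0 1 x] by (simp add: monom_value_def)

lemma poly_value_variable: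
  "poly_value (Poly_Mapping.single (Poly_Mapping.single i 1) 1) x = x $ i"
proof -
  have "monom_value (Poly_Mapping.single i 1) x = (\<Prod>j\<in>UNIV. if j = i then x $ j else 1)"
    unfolding monom_value_def by (intro prod.cong) (auto simp: lookup_single when_def)
  thus ?thesis by (simp add: poly_value_single)
qed

lemma poly_value_add: "poly_value (f + g) x = poly_value f x + poly_value g x"
proof -
  let ?A = "Poly_Mapping.keys f \<union> Poly_Mapping.keys g"
  have "Poly_Mapping.keys (f + g) \<subseteq> ?A" by (rule Poly_Mapping.keys_add)
  thus ?thesis
    by (simp add: poly_value_superset[of ?A] lookup_add algebra_simps sum.distrib)
qed

lemma poly_value_sum: "poly_value (sum f A) x = (\<Sum>a\<in>A. poly_value (f a) x)"
  by (induction A rule: infinite_finite_induct) (auto simp: poly_value_add)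

lemma poly_eq_sum_single:
  "(f :: 'n cpoly) = (\<Sum>m\<in>Poly_Mapping.keys f. Poly_Mapping.single m (Poly_Mapping.lookup f m))"
proof (rule poly_mapping_eqI)
  fix k
  have "(\<Sum>m\<in>Poly_Mapping.keys f. Poly_Mapping.lookup (Poly_Mapping.single m (Poly_Mapping.lookup f m)) k)
      = (\<Sum>m\<in>Poly_Mapping.keys f. if m = k then Poly_Mapping.lookup f m else 0)"
    by (intro sum.cong refl) (auto simp: lookup_single when_def)
  thus "Poly_Mapping.lookup f k = Poly_Mapping.lookup
     (\<Sum>m\<in>Poly_Mapping.keys f. Poly_Mapping.single m (Poly_Mapping.lookup f m)) k"
    by (simp add: lookup_sum in_keys_iff)
qed

lemma monom_value_add: "monom_value (m + k) x = monom_value m x * monom_value k x"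
  by (simp add: monom_value_def lookup_add power_add prod.distrib)

lemma poly_value_mult: "poly_value (f * g) x = poly_value f x * poly_value g x"
proof -
  have "poly_value (f * g) x = poly_value
     ((\<Sum>m\<in>Poly_Mapping.keys f. Poly_Mapping.single m (Poly_Mapping.lookup f m)) *
      (\<Sum>m\<in>Poly_Mapping.keys g. Poly_Mapping.single m (Poly_Mapping.lookup g m))) x"
    using poly_eq_sum_single[of f] poly_eq_sum_single[of g] by simp
  also have "\<dots> = (\<Sum>m\<in>Poly_Mapping.keys f. \<Sum>k\<in>Poly_Mapping.keys g.
      (Poly_Mapping.lookup f m * monom_value m x) * (Poly_Mapping.lookup g k * monom_value k x))"
    by (simp add: sum_product poly_value_sum mult_single poly_value_single monom_value_add mult_ac)
  also have "\<dots> = poly_value f x * poly_value g x"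
    by (simp add: poly_value_def sum_product)
  finally show ?thesis .
qed

end

(*
A direction v lies outside the geometric cone as soon as some f vanishing on V has f*(v) nonzero,
because t_k^d f(x_k) tends to f*(v) for d = deg f.

Conversely let v lie in the algebraic cone, v nonzero. The f with f*(v) nonzero form a multiplicative
set disjoint from I(V), so some prime ideal P containing I(V) avoids it; let W be the zero set of P.
Suppose v is not a limit direction of W at infinity. Among the linear projections p whose kernel
contains v and contains no nonzero limit direction of W, choose one with kernel as large as possible.
By compactness |x| <= K (1 + |p x|) on W, and by maximality no nonzero polynomial in p x lies in P.
Let l be a linear form with l(v) = 1 and l o p = 0. Generic zeros of P in the variables (p x, l x)
lift to W, so l is algebraic modulo P over the polynomials in p x, and the roots of its minimal
polynomial sum_j a_j(p x) T^j, of degree d, are bounded by K' (1 + |p x|). Hence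
|a_j| <= K'' (1 + |p x|)^(d-j) |a_d|, which forces a_d to divide a_j with a quotient q_j of degree at
most d - j. So l^d + sum_(j<d) q_j(p x) l^j lies in P, although its top form at v is l(v)^d = 1:
a contradiction.
*)

theory Submission
  imports Defs "HOL-Computational_Algebra.Fundamental_Theorem_Algebra"
    "HOL-Library.Function_Algebras"
begin

section \<open>Prime ideals avoiding a multiplicative set, and minimal relations modulo a prime\<close>

text \<open>The contradiction needs a member of \<open>P\<close> that is monic in l, whereas
  algebraic dependence only gives a relation whose leading coefficient a_d varies with p x. The
  estimate on W cannot be applied to all roots of that relation at once: over special points a root
  need not come from a point of W. Hence an auxiliary polynomial c in p x, outside \<open>P\<close>,
  such that all roots lift wherever c is nonzero. After multiplication by c the coefficient bounds
  hold everywhere, and since \<open>P\<close> is prime, c a_d can be cancelled at the end; this is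
  why V is first replaced by an irreducible W. The lifting adds one coordinate at a time by
  elimination and takes the place of the Nullstellensatz; no finite generation of ideals is
  involved. That l is algebraic modulo \<open>P\<close> comes from the same estimate: a
  transcendental l would take almost every value over a single point.\<close>

definition subring_set :: "'r::comm_ring_1 set \<Rightarrow> bool" where
  "subring_set S \<longleftrightarrow> 1 \<in> S \<and> (\<forall>a\<in>S. \<forall>b\<in>S. a - b \<in> S \<and> a * b \<in> S)"

definition ideal_of :: "'r::comm_ring_1 set \<Rightarrow> 'r set \<Rightarrow> bool" where
  "ideal_of A P \<longleftrightarrow> P \<subseteq> A \<and> 0 \<in> P \<and> (\<forall>a\<in>P. \<forall>b\<in>P. a + b \<in> P) \<and> (\<forall>a\<in>A. \<forall>b\<in>P. a * b \<in> P)"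

definition prime_ideal_of :: "'r::comm_ring_1 set \<Rightarrow> 'r set \<Rightarrow> bool" where
  "prime_ideal_of A P \<longleftrightarrow> ideal_of A P \<and> 1 \<notin> P \<and>
     (\<forall>a\<in>A. \<forall>b\<in>A. a * b \<in> P \<longrightarrow> a \<in> P \<or> b \<in> P)"

lemma subring_setD:
  assumes "subring_set S"
  shows "1 \<in> S" "0 \<in> S" "a \<in> S \<Longrightarrow> b \<in> S \<Longrightarrow> a - b \<in> S" "a \<in> S \<Longrightarrow> b \<in> S \<Longrightarrow> a * b \<in> S"
    "a \<in> S \<Longrightarrow> - a \<in> S" "a \<in> S \<Longrightarrow> b \<in> S \<Longrightarrow> a + b \<in> S"
proof -
  show 1: "1 \<in> S" and m: "\<And>a b. a \<in> S \<Longrightarrow> b \<in> S \<Longrightarrow> a - b \<in> S"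
    "a \<in> S \<Longrightarrow> b \<in> S \<Longrightarrow> a * b \<in> S"
    using assms by (auto simp: subring_set_def)
  show 0: "0 \<in> S" using m(1)[OF 1 1] by simp
  show n: "\<And>a. a \<in> S \<Longrightarrow> - a \<in> S" using m(1)[OF 0] by simp
  show "a + b \<in> S" if "a \<in> S" "b \<in> S" using m(1)[OF that(1) n[OF that(2)]] by simp
qed

lemma subring_set_power: "subring_set S \<Longrightarrow> a \<in> S \<Longrightarrow> a ^ n \<in> S"
  by (induction n) (auto simp: subring_setD)

lemma subring_set_sum: "subring_set S \<Longrightarrow> (\<And>i. i \<in> I \<Longrightarrow> f i \<in> S) \<Longrightarrow> sum f I \<in> S"
  by (induction I rule: infinite_finite_induct) (auto simp: subring_setD)

lemma ideal_ofD:
  assumes "ideal_of A P" "subring_set A"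
  shows "a \<in> P \<Longrightarrow> a \<in> A" "0 \<in> P" "a \<in> P \<Longrightarrow> b \<in> P \<Longrightarrow> a + b \<in> P"
    "a \<in> A \<Longrightarrow> b \<in> P \<Longrightarrow> a * b \<in> P" "a \<in> P \<Longrightarrow> b \<in> A \<Longrightarrow> a * b \<in> P"
    "a \<in> P \<Longrightarrow> - a \<in> P" "a \<in> P \<Longrightarrow> b \<in> P \<Longrightarrow> a - b \<in> P"
proof -
  show "a \<in> P \<Longrightarrow> a \<in> A" and 0: "0 \<in> P" and
    p: "\<And>a b. a \<in> P \<Longrightarrow> b \<in> P \<Longrightarrow> a + b \<in> P" and
    t: "\<And>a b. a \<in> A \<Longrightarrow> b \<in> P \<Longrightarrow> a * b \<in> P"
    using assms(1) by (auto simp: ideal_of_def)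
  show "a \<in> P \<Longrightarrow> b \<in> A \<Longrightarrow> a * b \<in> P" using t[of b a] by (simp add: mult.commute)
  show n: "\<And>a. a \<in> P \<Longrightarrow> - a \<in> P"
    using t[of "-1"] subring_setD(5)[OF assms(2) subring_setD(1)[OF assms(2)]] by simp
  show "a \<in> P \<Longrightarrow> b \<in> P \<Longrightarrow> a - b \<in> P" using p[OF _ n, of a b] by simp
qed

lemma ideal_of_sum:
  "ideal_of A P \<Longrightarrow> subring_set A \<Longrightarrow> (\<And>i. i \<in> I \<Longrightarrow> f i \<in> P) \<Longrightarrow> sum f I \<in> P"
  by (induction I rule: infinite_finite_induct) (auto intro: ideal_ofD)

text \<open>Krull's argument: an ideal maximal among those that contain \<open>I\<close> and avoid
  \<open>M\<close> is prime, because adjoining any further element makes it meet \<open>M\<close>,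
  and \<open>M\<close> is closed under products.\<close>

lemma exists_prime_ideal_avoiding:
  assumes A: "subring_set A" and I: "ideal_of A I" and M: "M \<subseteq> A" "1 \<in> M"
    "\<And>a b. a \<in> M \<Longrightarrow> b \<in> M \<Longrightarrow> a * b \<in> M" and dis: "I \<inter> M = {}"
  obtains P where "prime_ideal_of A P" "I \<subseteq> P" "P \<inter> M = {}"
proof -
  let ?Z = "{J. ideal_of A J \<and> I \<subseteq> J \<and> J \<inter> M = {}}"
  have "\<exists>P\<in>?Z. \<forall>X\<in>?Z. P \<subseteq> X \<longrightarrow> X = P"
  proof (rule subset_Zorn_nonempty)
    show "?Z \<noteq> {}" using I dis by blast
    fix C assume ne: "C \<noteq> {}" and ch: "subset.chain ?Z C"
    have mem: "ideal_of A J" "I \<subseteq> J" "J \<inter> M = {}" if "J \<in> C" for J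
      using ch that by (auto simp: subset_chain_def)
    have "ideal_of A (\<Union>C)"
      unfolding ideal_of_def
    proof (intro conjI ballI)
      show "\<Union>C \<subseteq> A" using mem(1) unfolding ideal_of_def by blast
      show "0 \<in> \<Union>C" using ne mem(1) by (auto simp: ideal_of_def)
      show "a * b \<in> \<Union>C" if "a \<in> A" "b \<in> \<Union>C" for a b
        using that mem(1) unfolding ideal_of_def by blast
      fix a b assume "a \<in> \<Union>C" "b \<in> \<Union>C"
      then obtain J K where JK: "J \<in> C" "K \<in> C" "a \<in> J" "b \<in> K" by blast
      have "J \<subseteq> K \<or> K \<subseteq> J" using ch JK by (auto simp: subset_chain_def)
      then show "a + b \<in> \<Union>C"
        using JK mem(1)[OF JK(1)] mem(1)[OF JK(2)] unfolding ideal_of_def by blast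
    qed
    then show "\<Union>C \<in> ?Z" using mem ne by blast
  qed
  then obtain P where P: "ideal_of A P" "I \<subseteq> P" "P \<inter> M = {}"
    and max: "\<And>X. ideal_of A X \<Longrightarrow> P \<subseteq> X \<Longrightarrow> X \<inter> M = {} \<Longrightarrow> X = P"
    by (smt (verit) mem_Collect_eq order_trans)
  note D = ideal_ofD[OF P(1) A] and S = subring_setD[OF A]
  have ext: "\<exists>p\<in>P. \<exists>r\<in>A. p + r * a \<in> M" if a: "a \<in> A" "a \<notin> P" for a
  proof (rule ccontr)
    assume no: "\<not> ?thesis"
    let ?J = "{p + r * a | p r. p \<in> P \<and> r \<in> A}"
    have "ideal_of A ?J"
      unfolding ideal_of_def
    proof (intro conjI ballI)
      show "?J \<subseteq> A" using a D(1) S(4,6) by blast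
      have "0 = 0 + 0 * a" by simp
      then show "0 \<in> ?J" using D(2) S(2) by blast
      show "x + y \<in> ?J" if xy: "x \<in> ?J" "y \<in> ?J" for x y
      proof -
        obtain p r p' r' where *: "x = p + r * a" "y = p' + r' * a" "p \<in> P" "p' \<in> P" "r \<in> A" "r' \<in> A"
          using xy by blast
        have "x + y = (p + p') + (r + r') * a" using * by (simp add: algebra_simps)
        then show ?thesis using * D(3) S(6) by blast
      qed
      show "x * y \<in> ?J" if xy: "x \<in> A" "y \<in> ?J" for x y
      proof -
        obtain p r where *: "y = p + r * a" "p \<in> P" "r \<in> A"
          using xy by blast
        have "x * y = (x * p) + (x * r) * a" using * by (simp add: algebra_simps)
        then show ?thesis using * xy(1) D(4) S(4) by blast
      qed
    qed
    moreover have "P \<subseteq> ?J"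
    proof
      fix x assume "x \<in> P"
      moreover have "x = x + 0 * a" by simp
      ultimately show "x \<in> ?J" using S(2) by blast
    qed
    moreover have "?J \<inter> M = {}" using no by blast
    ultimately have "?J = P" by (rule max)
    moreover have "a = 0 + 1 * a" by simp
    then have "a \<in> ?J" using D(2) S(1) by blast
    ultimately show False using a(2) by blast
  qed
  have "prime_ideal_of A P"
    unfolding prime_ideal_of_def
  proof (intro conjI ballI impI)
    show "ideal_of A P" by fact
    show "1 \<notin> P" using P(3) M(2) by blast
    fix a b assume ab: "a \<in> A" "b \<in> A" "a * b \<in> P"
    show "a \<in> P \<or> b \<in> P"
    proof (rule ccontr)
      assume "\<not> ?thesis"
      then obtain p r p' r' where *: "p + r * a \<in> M" "p' + r' * b \<in> M"
          "p \<in> P" "p' \<in> P" "r \<in> A" "r' \<in> A"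
        using ext[OF ab(1)] ext[OF ab(2)] by blast
      have "(p + r * a) * (p' + r' * b) = p * (p' + r' * b) + (r * a) * p' + (r * r') * (a * b)"
        by (simp add: algebra_simps)
      also have "\<dots> \<in> P"
      proof (intro D(3))
        show "p * (p' + r' * b) \<in> P" using D(5) * M(1) by blast
        show "(r * a) * p' \<in> P" "(r * r') * (a * b) \<in> P" using D(4) S(4) * ab by blast+
      qed
      finally show False using M(3)[OF *(1,2)] P(3) by blast
    qed
  qed
  then show ?thesis using that P by blast
qed

section \<open>Pseudo-division over a subring and minimal relations modulo a prime\<close>

definition polys_over :: "'r::comm_ring_1 set \<Rightarrow> 'r poly set" where
  "polys_over S = {p. \<forall>i. coeff p i \<in> S}"

lemma polys_over_coeff: "p \<in> polys_over S \<Longrightarrow> coeff p i \<in> S"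
  by (simp add: polys_over_def)

lemma polys_over_arith:
  assumes "subring_set S"
  shows "0 \<in> polys_over S" "1 \<in> polys_over S"
    "p \<in> polys_over S \<Longrightarrow> q \<in> polys_over S \<Longrightarrow> p + q \<in> polys_over S"
    "p \<in> polys_over S \<Longrightarrow> q \<in> polys_over S \<Longrightarrow> p - q \<in> polys_over S"
    "p \<in> polys_over S \<Longrightarrow> q \<in> polys_over S \<Longrightarrow> p * q \<in> polys_over S"
    "p \<in> polys_over S \<Longrightarrow> - p \<in> polys_over S"
    "a \<in> S \<Longrightarrow> p \<in> polys_over S \<Longrightarrow> smult a p \<in> polys_over S"
    "a \<in> S \<Longrightarrow> p \<in> polys_over S \<Longrightarrow> pCons a p \<in> polys_over S"
    "a \<in> S \<Longrightarrow> monom a n \<in> polys_over S"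
  using assms
  by (auto simp: polys_over_def coeff_mult coeff_1 coeff_pCons split: nat.split
      intro!: subring_setD subring_set_sum)

lemma polys_over_poly:
  "subring_set A \<Longrightarrow> S \<subseteq> A \<Longrightarrow> t \<in> A \<Longrightarrow> p \<in> polys_over S \<Longrightarrow> poly p t \<in> A"
  unfolding poly_altdef
  by (intro subring_set_sum subring_setD subring_set_power) (auto simp: polys_over_def)

text \<open>Powers of the leading coefficient stand in for its inverse, which need not exist in
  \<open>S\<close>. The bound on \<open>degree Q\<close> serves \<open>relation_pol_inverse\<close>,
  where a quotient must have smaller degree than a minimal relation.\<close>

lemma pseudo_division_over:
  assumes S: "subring_set S" and F: "F \<in> polys_over S" and G: "G \<in> polys_over S"
  shows "\<exists>N. \<exists>Q\<in>polys_over S. \<exists>R\<in>polys_over S. smult (lead_coeff F ^ N) G = Q * F + R \<and>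
    (R = 0 \<or> degree R < degree F) \<and> degree Q \<le> degree G - degree F"
  using G
proof (induction "degree G" arbitrary: G rule: less_induct)
  case less
  let ?a = "lead_coeff F" and ?d = "degree F"
  note P = polys_over_arith[OF S]
  have aS: "?a \<in> S" using F by (auto simp: polys_over_def)
  show ?case
  proof (cases "degree G < ?d \<or> G = 0")
    case True
    then have "smult (?a ^ 0) G = 0 * F + G \<and> (G = 0 \<or> degree G < ?d) \<and>
        degree (0 :: 'a poly) \<le> degree G - ?d" by auto
    then show ?thesis using less.prems P(1) by blast
  next
    case False
    let ?n = "degree G - ?d"
    let ?m = "monom (lead_coeff G) ?n"
    let ?G = "smult ?a G - ?m * F"
    have m: "?m \<in> polys_over S" using less.prems by (intro P(9)) (auto simp: polys_over_def)
    have dm: "degree (?m * F) \<le> degree G"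
      using degree_mult_le[of ?m F] degree_monom_le[of "lead_coeff G" ?n] False by auto
    have "coeff (?m * F) (degree G) = coeff (?m * F) (?n + ?d)" using False by simp
    also have "\<dots> = lead_coeff G * ?a" by (simp only: coeff_monom_mult) simp
    finally have c: "coeff ?G (degree G) = 0" by simp
    have dG: "degree ?G \<le> degree G"
      using dm degree_smult_le[of ?a G] by (intro degree_diff_le) auto
    have GS: "?G \<in> polys_over S" using m F less.prems aS by (intro P(4,5,7))
    show ?thesis
    proof (cases "?G = 0")
      case True
      then have "smult (?a ^ 1) G = ?m * F + 0 \<and> (0 = (0 :: 'a poly) \<or> degree (0 :: 'a poly) < ?d)
         \<and> degree ?m \<le> ?n" by (auto simp: degree_monom_le)
      then show ?thesis using m P(1) by blast
    next
      case G0: False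
      have "degree ?G \<noteq> degree G" using c G0 by (metis leading_coeff_0_iff)
      then have lt: "degree ?G < degree G" using dG by linarith
      obtain N Q R where *: "Q \<in> polys_over S" "R \<in> polys_over S"
          "smult (?a ^ N) ?G = Q * F + R" "R = 0 \<or> degree R < ?d" "degree Q \<le> degree ?G - ?d"
        using less.hyps[OF lt GS] by blast
      let ?Q = "Q + smult (?a ^ N) ?m"
      have "smult (?a ^ Suc N) G = smult (?a ^ N) ?G + smult (?a ^ N) (?m * F)"
        by (simp add: smult_diff_right mult.commute)
      also have "\<dots> = ?Q * F + R" unfolding *(3) by (simp add: algebra_simps)
      finally have "smult (?a ^ Suc N) G = ?Q * F + R" .
      moreover have "?Q \<in> polys_over S" using * m aS by (intro P(3,7) subring_set_power[OF S])
      moreover have "degree ?Q \<le> ?n"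
        using *(5) lt degree_monom_le[of "lead_coeff G" ?n] degree_smult_le[of "?a ^ N" ?m]
        by (intro degree_add_le) auto
      ultimately show ?thesis using * by blast
    qed
  qed
qed


text \<open>This is the domain \<open>A\<close>/\<open>P\<close>, with \<open>t\<close> viewed over
  the image of \<open>S\<close>, but without forming the quotient. Rings are sets rather than types
  because \<open>S\<close> will be the ring of polynomials in p x for a varying projection
  p.\<close>

locale prime_extension =
  fixes A P S :: "'r::comm_ring_1 set" and t :: 'r
  assumes A: "subring_set A" and P: "prime_ideal_of A P"
    and S: "subring_set S" and SA: "S \<subseteq> A" and tA: "t \<in> A"
begin

lemma ideal_P: "ideal_of A P" using P by (simp add: prime_ideal_of_def)

lemmas Pcl = ideal_ofD[OF ideal_P A]

lemma prime_P: "a \<in> A \<Longrightarrow> b \<in> A \<Longrightarrow> a * b \<in> P \<Longrightarrow> a \<in> P \<or> b \<in> P"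
  using P by (simp add: prime_ideal_of_def)

lemma prime_P_power: "a \<in> A \<Longrightarrow> a ^ n \<in> P \<Longrightarrow> a \<in> P"
proof (induction n)
  case 0 then show ?case using P by (simp add: prime_ideal_of_def)
next
  case (Suc n)
  then show ?case using prime_P[of a "a ^ n"] subring_set_power[OF A] by auto
qed

lemma poly_in_A: "p \<in> polys_over S \<Longrightarrow> poly p t \<in> A"
  by (rule polys_over_poly[OF A SA tA])

text \<open>The coefficients above the last one outside \<open>P\<close> are zero modulo
  \<open>P\<close>; dropping them changes the value at \<open>t\<close> only by an element of
  \<open>P\<close>. Afterwards the degree is the one seen in
  \<open>A\<close>/\<open>P\<close>.\<close>

lemma trim:
  assumes G: "G \<in> polys_over S" and ne: "\<exists>i. coeff G i \<notin> P"
  obtains H where "H \<in> polys_over S" "lead_coeff H \<notin> P" "degree H \<le> degree G"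
    "poly G t - poly H t \<in> P"
proof -
  have bd: "coeff G i \<notin> P \<Longrightarrow> i \<le> degree G" for i
    using Pcl(2) by (metis le_degree)
  let ?k = "GREATEST i. coeff G i \<notin> P"
  have k: "coeff G ?k \<notin> P" using ne bd by (metis (mono_tags, lifting) GreatestI_nat)
  have gt: "coeff G i \<in> P" if "i > ?k" for i
  proof (rule ccontr)
    assume "coeff G i \<notin> P"
    then have "i \<le> ?k" using bd by (intro Greatest_le_nat) auto
    then show False using that by simp
  qed
  let ?H = "\<Sum>i\<le>?k. monom (coeff G i) i"
  have c: "coeff ?H i = (if i \<le> ?k then coeff G i else 0)" for i
    by (simp add: coeff_sum)
  have dH: "degree ?H = ?k"
  proof (rule antisym)
    show "degree ?H \<le> ?k" by (rule degree_le) (auto simp: c)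
    have "coeff ?H ?k \<noteq> 0" using k Pcl(2) by (auto simp: c)
    then show "?k \<le> degree ?H" by (rule le_degree)
  qed
  have d: "coeff (G - ?H) i \<in> P" for i using gt Pcl(2) by (auto simp: c)
  show ?thesis
  proof
    show "?H \<in> polys_over S" using G subring_setD[OF S] by (auto simp: polys_over_def c)
    show "lead_coeff ?H \<notin> P" unfolding dH using k by (simp add: c)
    show "degree ?H \<le> degree G" unfolding dH using k bd by blast
    have "poly (G - ?H) t \<in> P"
      unfolding poly_altdef
      by (intro ideal_of_sum[OF ideal_P A] Pcl(5) d subring_set_power[OF A tA])
    then show "poly G t - poly ?H t \<in> P" by simp
  qed
qed

text \<open>
  Minimal polynomials of \<open>t\<close> over \<open>S\<close> modulo \<open>P\<close>, up to a leading coefficient that cannot be inverted in \<open>S\<close>.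
\<close>

definition relation_pol :: "'r poly \<Rightarrow> bool" where
  "relation_pol F \<longleftrightarrow> F \<in> polys_over S \<and> poly F t \<in> P \<and> lead_coeff F \<notin> P \<and>
    (\<forall>G\<in>polys_over S. poly G t \<in> P \<longrightarrow> degree G < degree F \<longrightarrow> (\<forall>i. coeff G i \<in> P))"

lemma relation_pol_exists:
  assumes "G \<in> polys_over S" "poly G t \<in> P" "coeff G i \<notin> P"
  obtains F where "relation_pol F"
proof -
  let ?Q = "\<lambda>F. F \<in> polys_over S \<and> poly F t \<in> P \<and> lead_coeff F \<notin> P"
  have ex: "\<exists>H. ?Q H \<and> degree H \<le> degree G"
    if G: "G \<in> polys_over S" "poly G t \<in> P" "coeff G i \<notin> P" for G i
  proof -
    obtain H where H: "H \<in> polys_over S" "lead_coeff H \<notin> P" "degree H \<le> degree G"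
      "poly G t - poly H t \<in> P" using trim G by blast
    have "poly H t = poly G t - (poly G t - poly H t)" by simp
    then show ?thesis using H G Pcl(7) by metis
  qed
  obtain H where "?Q H" using ex assms by blast
  define F where "F = arg_min degree ?Q"
  have F: "?Q F" "\<And>G. ?Q G \<Longrightarrow> degree F \<le> degree G"
    unfolding F_def using arg_min_nat_lemma[of ?Q H degree] \<open>?Q H\<close> by auto
  have "relation_pol F"
    unfolding relation_pol_def
  proof (intro conjI ballI impI allI)
    fix G i assume G: "G \<in> polys_over S" "poly G t \<in> P" "degree G < degree F"
    show "coeff G i \<in> P"
      using ex[OF G(1,2), of i] F(2) G(3) by (meson leD order.trans)
  qed (use F in auto)
  then show ?thesis using that by blast
qed

lemma relation_pol_degree_pos:
  assumes "relation_pol F" shows "degree F > 0"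
proof (rule ccontr)
  assume "\<not> ?thesis"
  then obtain c where "F = [:c:]" by (metis degree_eq_zeroE gr0I)
  then show False using assms by (simp add: relation_pol_def)
qed

text \<open>The pseudo-remainder takes a value in \<open>P\<close> and has smaller degree than
  \<open>F\<close>, so the minimality of \<open>F\<close> puts all its coefficients into
  \<open>P\<close>.\<close>

lemma relation_pol_divides:
  assumes F: "relation_pol F" and G: "G \<in> polys_over S" "poly G t \<in> P"
  obtains N Q R where "smult (lead_coeff F ^ N) G = Q * F + R" "R \<in> polys_over S"
    "\<And>i. coeff R i \<in> P"
proof -
  have FS: "F \<in> polys_over S" "poly F t \<in> P" using F by (auto simp: relation_pol_def)
  obtain N Q R where *: "Q \<in> polys_over S" "R \<in> polys_over S"
    "smult (lead_coeff F ^ N) G = Q * F + R" "R = 0 \<or> degree R < degree F"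
    using pseudo_division_over[OF S FS(1) G(1)] by blast
  have a: "lead_coeff F \<in> A" using FS SA by (auto simp: polys_over_def)
  have "poly R t = lead_coeff F ^ N * poly G t - poly Q t * poly F t"
    using arg_cong[OF *(3), of "\<lambda>p. poly p t"] by simp
  also have "\<dots> \<in> P"
    using G FS * a by (intro Pcl(7) Pcl(4) subring_set_power[OF A] poly_in_A)
  finally have "\<forall>i. coeff R i \<in> P"
    using *(2,4) F Pcl(2) by (cases "R = 0") (auto simp: relation_pol_def)
  then show ?thesis using * that by blast
qed

text \<open>An element algebraic over a field has its inverse in the field extension it generates;
  this is that fact for the nonzero class of \<open>poly G t\<close>, with \<open>c\<close> as
  cleared denominator. The proof takes a multiple of \<open>poly G t\<close> outside
  \<open>P\<close>, written as \<open>poly H t\<close> with \<open>degree H\<close> least, and shows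
  that \<open>H\<close> is constant.\<close>

lemma relation_pol_inverse:
  assumes F: "relation_pol F" and G: "G \<in> polys_over S" "poly G t \<notin> P"
  obtains W c where "W \<in> polys_over S" "c \<in> S" "c \<notin> P" "poly W t * poly G t - c \<in> P"
proof -
  note PS = polys_over_arith[OF S]
  have FS: "F \<in> polys_over S" "poly F t \<in> P" "lead_coeff F \<notin> P"
    using F by (auto simp: relation_pol_def)
  have aF: "lead_coeff F \<in> S" using FS by (auto simp: polys_over_def)
  define Q where "Q = (\<lambda>H. H \<in> polys_over S \<and> poly H t \<notin> P \<and> lead_coeff H \<notin> P \<and>
      (\<exists>W\<in>polys_over S. poly W t * poly G t - poly H t \<in> P))"
  have ex: "\<exists>H. Q H \<and> degree H \<le> degree K"
    if K: "K \<in> polys_over S" "poly K t \<notin> P" "W \<in> polys_over S" "poly W t * poly G t - poly K t \<in> P"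
    for K W
  proof -
    have "\<exists>i. coeff K i \<notin> P"
    proof (rule ccontr)
      assume "\<not> ?thesis"
      then have "poly K t \<in> P"
        unfolding poly_altdef
        by (intro ideal_of_sum[OF ideal_P A] Pcl(5) subring_set_power[OF A tA]) auto
      then show False using K by blast
    qed
    then obtain H where H: "H \<in> polys_over S" "lead_coeff H \<notin> P" "degree H \<le> degree K"
      "poly K t - poly H t \<in> P" using trim K by blast
    have "poly K t = (poly K t - poly H t) + poly H t" by simp
    then have "poly H t \<notin> P" using H K Pcl(3) by metis
    moreover have "poly W t * poly G t - poly H t =
        (poly W t * poly G t - poly K t) + (poly K t - poly H t)" by simp
    then have "poly W t * poly G t - poly H t \<in> P" using H K Pcl(3) by metis
    ultimately show ?thesis using H K by (auto simp: Q_def)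
  qed
  have "\<exists>H. Q H" using ex[of G 1] G PS Pcl(2) by auto
  then obtain H0 where "Q H0" ..
  define H where "H = arg_min degree Q"
  have H: "Q H" and min: "\<And>K. Q K \<Longrightarrow> degree H \<le> degree K"
    unfolding H_def using arg_min_nat_lemma[of Q H0 degree] \<open>Q H0\<close> by auto
  obtain W where W: "W \<in> polys_over S" "poly W t * poly G t - poly H t \<in> P"
    and HS: "H \<in> polys_over S" "poly H t \<notin> P" "lead_coeff H \<notin> P"
    using H by (auto simp: Q_def)
  have aH: "lead_coeff H \<in> S" using HS by (auto simp: polys_over_def)
  \<comment> \<open>A multiple of \<open>poly H t\<close> modulo \<open>P\<close> is again a
    multiple of \<open>poly G t\<close>, so no such element outside \<open>P\<close> can have a
    representative of smaller degree.\<close>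
  have small: "degree H \<le> degree K"
    if "K \<in> polys_over S" "poly K t \<notin> P" "U \<in> polys_over S" "poly K t - poly U t * poly H t \<in> P"
    for K U
  proof -
    have "poly (U * W) t * poly G t - poly K t =
       poly U t * (poly W t * poly G t - poly H t) - (poly K t - poly U t * poly H t)"
      by (simp add: algebra_simps)
    also have "\<dots> \<in> P" by (rule Pcl(7)[OF Pcl(4)[OF poly_in_A[OF that(3)] W(2)] that(4)])
    finally have "\<exists>H. Q H \<and> degree H \<le> degree K"
      using ex[of K "U * W"] that W PS(5) by blast
    then show ?thesis using min order.trans by blast
  qed
  \<comment> \<open>Otherwise the pseudo-remainder of \<open>H\<close> by \<open>F\<close> would be
    a smaller representative.\<close>
  have lt: "degree H < degree F"
  proof -
    obtain N U R where *: "U \<in> polys_over S" "R \<in> polys_over S"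
      "smult (lead_coeff F ^ N) H = U * F + R" "R = 0 \<or> degree R < degree F"
      using pseudo_division_over[OF S FS(1) HS(1)] by blast
    have e: "lead_coeff F ^ N * poly H t = poly U t * poly F t + poly R t"
      using arg_cong[OF *(3), of "\<lambda>p. poly p t"] by simp
    have "poly U t * poly F t \<in> P" using * FS by (intro Pcl(4) poly_in_A)
    have "poly R t \<notin> P"
    proof
      assume "poly R t \<in> P"
      then have "lead_coeff F ^ N * poly H t \<in> P"
        unfolding e using \<open>poly U t * poly F t \<in> P\<close> by (intro Pcl(3))
      then show False
        using prime_P[of "lead_coeff F ^ N" "poly H t"] prime_P_power[of "lead_coeff F" N] aF SA HS FS
          poly_in_A subring_set_power[OF A] by blast
    qed
    moreover have "poly R t - poly [:lead_coeff F ^ N:] t * poly H t = - (poly U t * poly F t)"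
      using e by (simp add: algebra_simps)
    moreover have "[:lead_coeff F ^ N:] \<in> polys_over S"
      by (intro PS(8) PS(1) subring_set_power[OF S] aF)
    ultimately have "degree H \<le> degree R"
      using small[of R "[:lead_coeff F ^ N:]"] * Pcl(6)[OF \<open>poly U t * poly F t \<in> P\<close>] by metis
    moreover have "R \<noteq> 0" using \<open>poly R t \<notin> P\<close> Pcl(2) by auto
    ultimately show ?thesis using *(4) by auto
  qed
  \<comment> \<open>Divide \<open>F\<close> by \<open>H\<close> instead. The remainder takes a value
    in \<open>P\<close> by minimality of \<open>H\<close>, hence so does the quotient
    \<open>U\<close> by primality. If \<open>H\<close> is not constant, \<open>U\<close> has smaller
    degree than \<open>F\<close>, so its coefficients lie in \<open>P\<close>; the coefficient at
    \<open>degree F\<close> then puts a product of leading coefficients into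
    \<open>P\<close>.\<close>
  have "degree H = 0"
  proof (rule ccontr)
    assume pos: "degree H \<noteq> 0"
    obtain N U R where *: "U \<in> polys_over S" "R \<in> polys_over S"
      "smult (lead_coeff H ^ N) F = U * H + R" "R = 0 \<or> degree R < degree H"
      "degree U \<le> degree F - degree H"
      using pseudo_division_over[OF S HS(1) FS(1)] by blast
    have e: "lead_coeff H ^ N * poly F t = poly U t * poly H t + poly R t"
      using arg_cong[OF *(3), of "\<lambda>p. poly p t"] by simp
    have p: "lead_coeff H ^ N * poly F t \<in> P"
      using FS aH SA by (intro Pcl(4) subring_set_power[OF A]) auto
    have "poly R t \<in> P"
    proof (rule ccontr)
      assume R: "poly R t \<notin> P"
      have "poly R t - poly (- U) t * poly H t = lead_coeff H ^ N * poly F t"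
        using e by (simp add: algebra_simps)
      then have "degree H \<le> degree R" using small[of R "- U"] * R p PS(6) by metis
      then show False using *(4) R Pcl(2) by auto
    qed
    moreover have "poly U t * poly H t = lead_coeff H ^ N * poly F t - poly R t"
      using e by simp
    ultimately have "poly U t * poly H t \<in> P" using p Pcl(7) by metis
    then have "poly U t \<in> P"
      using prime_P poly_in_A * HS by blast
    moreover have "degree U < degree F" using *(5) pos lt by linarith
    ultimately have U: "coeff U i \<in> P" for i using F * by (auto simp: relation_pol_def)
    have "coeff (U * H) (degree F) \<in> P"
      unfolding coeff_mult
      using HS SA U by (intro ideal_of_sum[OF ideal_P A] Pcl(5)) (auto simp: polys_over_def)
    moreover have "coeff R (degree F) = 0" using *(4) lt by (auto intro: coeff_eq_0)
    moreover have "lead_coeff H ^ N * lead_coeff F = coeff (U * H) (degree F) + coeff R (degree F)"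
      using arg_cong[OF *(3), of "\<lambda>p. coeff p (degree F)"] by simp
    ultimately have "lead_coeff H ^ N * lead_coeff F \<in> P" by simp
    then show False
      using prime_P[of "lead_coeff H ^ N" "lead_coeff F"] prime_P_power[of "lead_coeff H" N]
        aF aH SA HS FS subring_set_power[OF A] by blast
  qed
  then obtain c where c: "H = [:c:]" by (rule degree_eq_zeroE)
  show ?thesis
  proof (rule that[of W c])
    show "c \<in> S" "c \<notin> P" using c aH HS by auto
  qed (use W c in auto)
qed

end

section \<open>Polynomial functions and growth\<close>

lemma norm_vector_mult: "norm (s *s x) = norm s * norm (x :: complex ^ 'n)"
  by (simp add: norm_vec_def norm_mult L2_set_right_distrib)

lemma scaleR_eq_vector_mult: "r *\<^sub>R (x :: complex ^ 'n) = complex_of_real r *s x"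
  by (simp add: vec_eq_iff) (simp add: scaleR_conv_of_real)

section \<open>Growth estimates for polynomials in one variable\<close>

lemma poly_eq_sum_coeff:
  fixes p :: "'a::comm_ring_1 poly"
  assumes "degree p \<le> n" shows "poly p x = (\<Sum>i\<le>n. coeff p i * x ^ i)"
  unfolding poly_altdef
  by (rule sum.mono_neutral_left) (use assms in \<open>auto simp: coeff_eq_0\<close>)

text \<open>Put s = 1/e: the reversed polynomial has the leading coefficient of \<open>b\<close> as
  its value at 0, while the bound makes it tend to 0 there as soon as \<open>degree b\<close>
  exceeds \<open>i\<close>.\<close>

lemma degree_le_of_growth:
  fixes b :: "complex poly"
  assumes b: "\<And>s. norm (poly b s) \<le> K * (1 + norm s) ^ i"
  shows "degree b \<le> i"
proof (rule ccontr)
  let ?n = "degree b"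
  assume "\<not> ?thesis"
  then have n: "?n = i + (?n - i)" "0 < ?n - i" by auto
  have ev: "\<forall>\<^sub>F e in at 0. norm (poly (reflect_poly b) e) \<le> K * (norm e + 1) ^ i * norm e ^ (?n - i)"
  proof (rule eventually_at_topological[THEN iffD2], intro exI conjI ballI impI)
    show "open (UNIV :: complex set)" by simp
    fix e :: complex assume e: "e \<noteq> 0"
    have "norm (poly (reflect_poly b) e) = norm e ^ ?n * norm (poly b (inverse e))"
      using e by (simp add: poly_reflect_poly_nz norm_mult norm_power)
    also have "\<dots> \<le> norm e ^ ?n * (K * (1 + norm (inverse e)) ^ i)"
      by (intro mult_left_mono b) auto
    also have "norm e ^ ?n = norm e ^ i * norm e ^ (?n - i)"
      by (subst n(1)) (rule power_add)
    also have "norm e ^ i * norm e ^ (?n - i) * (K * (1 + norm (inverse e)) ^ i)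
        = K * (norm e * (1 + norm (inverse e))) ^ i * norm e ^ (?n - i)"
      by (simp add: power_mult_distrib mult_ac)
    also have "norm e * (1 + norm (inverse e)) = norm e + 1"
      using e by (simp add: norm_inverse algebra_simps)
    finally show "norm (poly (reflect_poly b) e) \<le> K * (norm e + 1) ^ i * norm e ^ (?n - i)" .
  qed auto
  have "((\<lambda>e. norm (poly (reflect_poly b) e)) \<longlongrightarrow> norm (poly (reflect_poly b) 0)) (at 0)"
    by (intro tendsto_intros)
  moreover have "((\<lambda>e::complex. K * (norm e + 1) ^ i * norm e ^ (?n - i)) \<longlongrightarrow>
      K * (norm (0::complex) + 1) ^ i * norm (0::complex) ^ (?n - i)) (at 0)"
    by (intro tendsto_intros)
  ultimately have "norm (poly (reflect_poly b) 0) \<le> K * (norm (0::complex) + 1) ^ i * norm (0::complex) ^ (?n - i)"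
    using ev by (intro tendsto_le[OF at_neq_bot])
  then have "lead_coeff b = 0" using n(2) by (simp add: power_0_left)
  then show False using n by auto
qed

text \<open>Every root of \<open>a\<close> is a root of \<open>b\<close>. Cancelling the common
  linear factor keeps the bound away from the root, and continuity restores it at the root.\<close>

lemma divides_of_growth:
  fixes a b :: "complex poly"
  assumes "a \<noteq> 0" "\<And>s. norm (poly b s) \<le> K * (1 + norm s) ^ i * norm (poly a s)"
  shows "\<exists>c. b = a * c \<and> degree c \<le> i"
  using assms
proof (induction "degree a" arbitrary: a b)
  case 0
  then obtain k where k: "a = [:k:]" "k \<noteq> 0" by (metis degree_eq_zeroE pCons_0_0)
  have "degree b \<le> i"
    by (rule degree_le_of_growth[where K = "K * norm k"]) (use 0 k in \<open>simp add: mult_ac\<close>)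
  then show ?case using k by (intro exI[of _ "smult (inverse k) b"]) auto
next
  case (Suc n)
  have "\<not> constant (poly a)" using Suc(2) by (simp add: constant_degree)
  then obtain r where r: "poly a r = 0" using fundamental_theorem_of_algebra by blast
  then have "poly b r = 0" using Suc.prems(2)[of r] by simp
  then obtain a1 b1 where ab: "a = [:-r, 1:] * a1" "b = [:-r, 1:] * b1"
    using r by (meson dvdE poly_eq_0_iff_dvd)
  have a1: "a1 \<noteq> 0" using ab Suc.prems by auto
  then have "degree a = Suc (degree a1)" unfolding ab by (subst degree_mult_eq) auto
  then have n: "n = degree a1" using Suc by simp
  have away: "norm (poly b1 s) \<le> K * (1 + norm s) ^ i * norm (poly a1 s)" if "s \<noteq> r" for s
  proof -
    have "norm (s - r) * norm (poly b1 s) \<le> norm (s - r) * (K * (1 + norm s) ^ i * norm (poly a1 s))"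
      using Suc.prems(2)[of s] by (simp only: ab poly_mult norm_mult) (simp add: mult_ac)
    then show ?thesis using that by (simp add: mult_le_cancel_left)
  qed
  have "norm (poly b1 r) \<le> K * (1 + norm r) ^ i * norm (poly a1 r)"
  proof (rule tendsto_le)
    show "((\<lambda>s. K * (1 + norm s) ^ i * norm (poly a1 s)) \<longlongrightarrow> K * (1 + norm r) ^ i * norm (poly a1 r)) (at r)"
      "((\<lambda>s. norm (poly b1 s)) \<longlongrightarrow> norm (poly b1 r)) (at r)" by (intro tendsto_intros)+
    show "\<forall>\<^sub>F s in at r. norm (poly b1 s) \<le> K * (1 + norm s) ^ i * norm (poly a1 s)"
      using away by (auto simp: eventually_at_topological)
  qed auto
  then have "\<exists>c. b1 = a1 * c \<and> degree c \<le> i"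
    using away by (intro Suc(1)[OF n a1]) metis
  then show ?case unfolding ab by (metis mult.assoc)
qed

text \<open>Splitting off one root writes each coefficient as a difference of two terms, both within
  the bound for the smaller degree; this doubling is the source of
  \<open>2 ^ degree q\<close>.\<close>

lemma coeff_bound_of_root_bound:
  fixes q :: "complex poly"
  assumes "\<And>r. poly q r = 0 \<Longrightarrow> norm r \<le> B" "0 \<le> B" "j \<le> degree q"
  shows "norm (coeff q j) \<le> norm (lead_coeff q) * 2 ^ degree q * B ^ (degree q - j)"
  using assms
proof (induction "degree q" arbitrary: q j)
  case 0 then show ?case by simp
next
  case (Suc n)
  have "\<not> constant (poly q)" using Suc(2) by (simp add: constant_degree)
  then obtain r where r: "poly q r = 0" using fundamental_theorem_of_algebra by blast
  then obtain p where p: "q = [:-r, 1:] * p" by (meson dvdE poly_eq_0_iff_dvd)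
  have p0: "p \<noteq> 0" using p Suc(2) by auto
  have dq: "degree q = Suc (degree p)" unfolding p using p0 by (subst degree_mult_eq) auto
  have lc: "lead_coeff q = lead_coeff p" unfolding p by (subst lead_coeff_mult) auto
  have IH: "norm (coeff p j) \<le> norm (lead_coeff p) * 2 ^ n * B ^ (n - j)" if "j \<le> n" for j
    using Suc(1)[of p j] that dq Suc by (auto simp: p)
  let ?L = "norm (lead_coeff p) * 2 ^ n"
  have rB: "norm r \<le> B" using r Suc.prems by blast
  have n: "n = degree p" using dq Suc(2) by simp
  have c: "coeff q j = (case j of 0 \<Rightarrow> 0 | Suc k \<Rightarrow> coeff p k) - r * coeff p j"
    by (simp add: p coeff_pCons split: nat.split)
  have 1: "norm (case j of 0 \<Rightarrow> 0 | Suc k \<Rightarrow> coeff p k) \<le> ?L * B ^ (Suc n - j)"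
  proof (cases j)
    case (Suc k) then show ?thesis using IH[of k] Suc.prems(3) dq n by simp
  qed (use Suc.prems(2) in simp)
  have 2: "norm (r * coeff p j) \<le> ?L * B ^ (Suc n - j)"
  proof (cases "j \<le> n")
    case True
    have "norm (r * coeff p j) \<le> B * (?L * B ^ (n - j))"
      unfolding norm_mult using IH[OF True] rB Suc.prems(2) by (intro mult_mono) auto
    also have "\<dots> = ?L * B ^ (Suc n - j)" using True by (simp add: Suc_diff_le)
    finally show ?thesis .
  next
    case False then show ?thesis using Suc.prems(2) n by (simp add: coeff_eq_0)
  qed
  have "norm (coeff q j) \<le> ?L * B ^ (Suc n - j) + ?L * B ^ (Suc n - j)"
    unfolding c using 1 2 norm_triangle_ineq4[of "case j of 0 \<Rightarrow> 0 | Suc k \<Rightarrow> coeff p k" "r * coeff p j"]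
    by linarith
  then have "norm (coeff q j) \<le> norm (lead_coeff p) * 2 ^ Suc n * B ^ (Suc n - j)" by (simp add: algebra_simps)
  then show ?case unfolding lc unfolding dq n[symmetric] .
qed

section \<open>Polynomial functions with a degree bound\<close>

definition clinear_map :: "(complex ^ 'n \<Rightarrow> complex ^ 'm) \<Rightarrow> bool" where
  "clinear_map p \<longleftrightarrow> (\<forall>x y. p (x + y) = p x + p y) \<and> (\<forall>c x. p (c *s x) = c *s p x)"

definition clinear_form :: "(complex ^ 'n \<Rightarrow> complex) \<Rightarrow> bool" where
  "clinear_form l \<longleftrightarrow> (\<forall>x y. l (x + y) = l x + l y) \<and> (\<forall>c x. l (c *s x) = c * l x)"

text \<open>The number is only an upper bound for the degree. Working with functions makes
  composition with linear maps and translation simple inductions; formal polynomials return in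
  \<open>polyf_representation\<close>.\<close>

inductive polyf :: "nat \<Rightarrow> (complex ^ 'n::finite \<Rightarrow> complex) \<Rightarrow> bool" where
  const: "polyf 0 (\<lambda>_. c)"
| coord: "polyf 1 (\<lambda>x. x $ i)"
| mono: "polyf d f \<Longrightarrow> d \<le> e \<Longrightarrow> polyf e f"
| add: "polyf d f \<Longrightarrow> polyf d g \<Longrightarrow> polyf d (\<lambda>x. f x + g x)"
| mult: "polyf d f \<Longrightarrow> polyf e g \<Longrightarrow> polyf (d + e) (\<lambda>x. f x * g x)"

lemma polyf_const: "polyf d (\<lambda>_. c)"
  by (rule polyf.mono[OF polyf.const]) simp

lemma polyf_cmult: "polyf d f \<Longrightarrow> polyf d (\<lambda>x. c * f x)"
  using polyf.mult[OF polyf.const] by simp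

lemma polyf_diff: "polyf d f \<Longrightarrow> polyf d g \<Longrightarrow> polyf d (\<lambda>x. f x - g x)"
  using polyf.add[of d f "\<lambda>x. (- 1) * g x"] polyf_cmult[of d g "- 1"] by simp

lemma polyf_sum: "(\<And>i. i \<in> I \<Longrightarrow> polyf d (f i)) \<Longrightarrow> polyf d (\<lambda>x. \<Sum>i\<in>I. f i x)"
  by (induction I rule: infinite_finite_induct) (auto intro: polyf_const polyf.add)

lemma polyf_power: "polyf d f \<Longrightarrow> polyf (d * n) (\<lambda>x. f x ^ n)"
  by (induction n) (auto intro: polyf_const polyf.mult)

lemma clinear_form_expand: "clinear_form l \<Longrightarrow> l x = (\<Sum>i\<in>UNIV. l (axis i 1) * x $ i)"
proof -
  assume l: "clinear_form l"
  have 0: "l 0 = 0" using l by (metis clinear_form_def mult_zero_left vector_smult_lzero)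
  have "l (\<Sum>i\<in>I. x $ i *s axis i 1) = (\<Sum>i\<in>I. l (axis i 1) * x $ i)" for I
    using l 0 by (induction I rule: infinite_finite_induct) (auto simp: clinear_form_def)
  from this[of UNIV] show ?thesis by (simp add: basis_expansion)
qed

lemma polyf_clinear_form: "clinear_form l \<Longrightarrow> polyf 1 l"
proof -
  assume l: "clinear_form l"
  have "polyf 1 (\<lambda>x. \<Sum>i\<in>UNIV. l (axis i 1) * x $ i)"
    by (intro polyf_sum polyf_cmult polyf.coord)
  then show ?thesis using clinear_form_expand[OF l] by (metis (no_types, lifting) ext)
qed

lemma polyf_comp: "polyf d f \<Longrightarrow> clinear_map p \<Longrightarrow> polyf d (\<lambda>x. f (p x))"
proof (induction rule: polyf.induct)
  case (coord i)
  then have "clinear_form (\<lambda>x. p x $ i)" by (simp add: clinear_form_def clinear_map_def)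
  then show ?case by (rule polyf_clinear_form)
qed (auto intro: polyf.intros)

lemma polyf_translate: "polyf d f \<Longrightarrow> polyf d (\<lambda>x. f (x + a))"
proof (induction rule: polyf.induct)
  case (coord i)
  then show ?case using polyf.add[OF polyf.coord polyf_const] by simp
qed (auto intro: polyf.intros)

lemma polyf_homogeneous_components:
  assumes "polyf d f"
  obtains h where "\<And>j. polyf j (h j)" "\<And>j s x. h j (s *s x) = s ^ j * h j x"
    "\<And>x. f x = (\<Sum>j\<le>d. h j x)" "\<And>j x. d < j \<Longrightarrow> h j x = 0"
proof -
  have "\<exists>h. (\<forall>j. polyf j (h j)) \<and> (\<forall>j s x. h j (s *s x) = s ^ j * h j x) \<and>
     (\<forall>x. f x = (\<Sum>j\<le>d. h j x)) \<and> (\<forall>j x. d < j \<longrightarrow> h j x = 0)"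
    using assms
  proof (induction rule: polyf.induct)
    case (const c)
    show ?case
      by (rule exI[of _ "\<lambda>j x. if j = 0 then c else 0"]) (auto intro: polyf_const)
  next
    case (coord i)
    have "polyf j (\<lambda>x. if j = 1 then x $ i else 0)" for j
      using polyf.coord by (cases "j = 1") (auto intro: polyf_const)
    then show ?case
      by (intro exI[of _ "\<lambda>j x. if j = 1 then x $ i else 0"]) auto
  next
    case (mono d f e)
    then obtain h where h: "\<And>j. polyf j (h j)" "\<And>j s x. h j (s *s x) = s ^ j * h j x"
      "\<And>x. f x = (\<Sum>j\<le>d. h j x)" "\<And>j x. d < j \<Longrightarrow> h j x = 0" by metis
    have "(\<Sum>j\<le>d. h j x) = (\<Sum>j\<le>e. h j x)" for x
      by (rule sum.mono_neutral_left) (use h mono in auto)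
    then show ?case using h mono by (intro exI[of _ h]) auto
  next
    case (add d f g)
    then obtain h k where "\<And>j. polyf j (h j)" "\<And>j s x. h j (s *s x) = s ^ j * h j x"
      "\<And>x. f x = (\<Sum>j\<le>d. h j x)" "\<And>j x. d < j \<Longrightarrow> h j x = 0"
      "\<And>j. polyf j (k j)" "\<And>j s x. k j (s *s x) = s ^ j * k j x"
      "\<And>x. g x = (\<Sum>j\<le>d. k j x)" "\<And>j x. d < j \<Longrightarrow> k j x = 0" by metis
    then show ?case
      by (intro exI[of _ "\<lambda>j x. h j x + k j x"]) (auto simp: algebra_simps sum.distrib intro: polyf.add)
  next
    case (mult d f e g)
    then obtain h k where h: "\<And>j. polyf j (h j)" "\<And>j s x. h j (s *s x) = s ^ j * h j x"
      "\<And>x. f x = (\<Sum>j\<le>d. h j x)" "\<And>j x. d < j \<Longrightarrow> h j x = 0"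
      and k: "\<And>j. polyf j (k j)" "\<And>j s x. k j (s *s x) = s ^ j * k j x"
      "\<And>x. g x = (\<Sum>j\<le>e. k j x)" "\<And>j x. e < j \<Longrightarrow> k j x = 0" by metis
    let ?m = "\<lambda>j x. \<Sum>i\<le>j. h i x * k (j - i) x"
    have "polyf j (?m j)" for j
    proof (rule polyf_sum)
      fix i assume "i \<in> {..j}"
      then show "polyf j (\<lambda>x. h i x * k (j - i) x)"
        using polyf.mult[OF h(1)[of i] k(1)[of "j - i"]] by simp
    qed
    moreover have "?m j (s *s x) = s ^ j * ?m j x" for j s x
      unfolding sum_distrib_left
    proof (rule sum.cong)
      fix i assume i: "i \<in> {..j}"
      have "s ^ j = s ^ i * s ^ (j - i)" using i by (simp flip: power_add)
      then show "h i (s *s x) * k (j - i) (s *s x) = s ^ j * (h i x * k (j - i) x)"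
        by (simp add: h k)
    qed simp
    moreover have z: "?m j x = 0" if "d + e < j" for j x
    proof (rule sum.neutral, rule ballI)
      fix i show "h i x * k (j - i) x = 0"
        using h(4)[of i x] k(4)[of "j - i" x] that by (cases "d < i") auto
    qed
    moreover have "f x * g x = (\<Sum>j\<le>d + e. ?m j x)" for x
    proof -
      \<comment> \<open>With the components as coefficients of one-variable polynomials, evaluating
        the product at 1 yields the Cauchy product without reindexing sums.\<close>
      let ?a = "\<Sum>i\<le>d. monom (h i x) i" and ?b = "\<Sum>i\<le>e. monom (k i x) i"
      have c: "coeff ?a i = h i x" "coeff ?b i = k i x" for i
        using h(4)[of i x] k(4)[of i x] by (simp_all add: coeff_sum not_le)
      have "degree ?a \<le> d" "degree ?b \<le> e" by (intro degree_le; simp add: c h k)+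
      then have "degree (?a * ?b) \<le> d + e" using degree_mult_le[of ?a ?b] by linarith
      then have "poly (?a * ?b) 1 = (\<Sum>j\<le>d + e. ?m j x)"
        by (subst poly_eq_sum_coeff) (auto simp: coeff_mult c)
      then show ?thesis by (simp add: poly_sum poly_monom h k)
    qed
    ultimately show ?case by (intro exI[of _ ?m]) auto
  qed
  then show ?thesis using that by blast
qed

text \<open>
  The homogeneous components of \<open>b / a\<close>, computed recursively from those of \<open>a\<close> and \<open>b\<close> when the
  constant component \<open>A 0\<close> of \<open>a\<close> is nonzero.
\<close>

fun quotient_component :: "(nat \<Rightarrow> 'a \<Rightarrow> complex) \<Rightarrow> (nat \<Rightarrow> 'a \<Rightarrow> complex) \<Rightarrow> nat \<Rightarrow> 'a \<Rightarrow> complex" where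
  "quotient_component A B j y =
     (B j y - (\<Sum>i<j. quotient_component A B i y * A (j - i) y)) / A 0 y"

declare quotient_component.simps [simp del]

text \<open>
  On every line through a point \<open>x0\<close> with \<open>a x0 \<noteq> 0\<close> the quotient \<open>b / a\<close> is a polynomial of degree at
  most \<open>i\<close>, so the components of its power series at \<open>x0\<close> vanish in degrees above \<open>i\<close>.
\<close>

lemma polyf_divides_of_growth:
  assumes a: "polyf m a" and b: "polyf n b" and x0: "a x0 \<noteq> 0" and K: "0 \<le> K"
    and bd: "\<And>x. norm (b x) \<le> K * (1 + norm x) ^ i * norm (a x)"
  obtains q where "polyf i q" "\<And>x. b x = a x * q x"
proof -
  obtain A where A: "\<And>j. polyf j (A j)" "\<And>j s x. A j (s *s x) = s ^ j * A j x"
    "\<And>x. a (x + x0) = (\<Sum>j\<le>m. A j x)" "\<And>j x. m < j \<Longrightarrow> A j x = 0"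
    using polyf_homogeneous_components[OF polyf_translate[OF a]] by metis
  obtain B where B: "\<And>j. polyf j (B j)" "\<And>j s x. B j (s *s x) = s ^ j * B j x"
    "\<And>x. b (x + x0) = (\<Sum>j\<le>n. B j x)" "\<And>j x. n < j \<Longrightarrow> B j x = 0"
    using polyf_homogeneous_components[OF polyf_translate[OF b]] by metis
  have A00: "A j 0 = 0" if "j > 0" for j using A(2)[of j 0 0] that by (simp add: zero_power)
  have "a x0 = (\<Sum>j\<in>{0}. A j 0)"
    using A(3)[of 0] by (simp add: A00 sum.mono_neutral_right[of "{..m}" "{0}"])
  then have A0: "A 0 y = a x0" for y using A(2)[of 0 0 y] by simp
  let ?Q = "quotient_component A B"
  have Q: "polyf j (?Q j)" for j
  proof (induction j rule: less_induct)
    case (less j)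
    have "polyf j (\<lambda>y. ?Q i y * A (j - i) y)" if "i \<in> {..<j}" for i
      using polyf.mult[OF less[of i] A(1)[of "j - i"]] that by simp
    then have "polyf j (\<lambda>y. inverse (a x0) * (B j y - (\<Sum>i<j. ?Q i y * A (j - i) y)))"
      by (intro polyf_cmult polyf_diff polyf_sum B)
    then show ?case
      by (simp add: quotient_component.simps[of A B j] A0 divide_inverse mult.commute)
  qed
  have main: "b (y + x0) = a (y + x0) * (\<Sum>j\<le>i. ?Q j y)" for y
  proof -
    let ?a = "\<Sum>i\<le>m. monom (A i y) i" and ?b = "\<Sum>i\<le>n. monom (B i y) i"
    have c: "coeff ?a j = A j y" "coeff ?b j = B j y" for j
      using A(4)[of j y] B(4)[of j y] by (simp_all add: coeff_sum not_le)
    have ev: "poly ?a s = a (s *s y + x0)" "poly ?b s = b (s *s y + x0)" for s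
      by (simp_all add: A B poly_sum poly_monom mult_ac)
    have "coeff ?a 0 \<noteq> 0" using c(1)[of 0] A0 x0 by simp
    then have "?a \<noteq> 0" by (metis coeff_0)
    \<comment> \<open>The constant may depend on \<open>y\<close>; what matters is that the exponent
      \<open>i\<close>, which bounds the degree of the quotient, does not.\<close>
    moreover have "norm (poly ?b s) \<le> (K * (1 + norm x0 + norm y) ^ i) * (1 + norm s) ^ i * norm (poly ?a s)"
      for s
    proof -
      have "1 + norm (s *s y + x0) \<le> 1 + (norm s * norm y + norm x0)"
        using norm_triangle_ineq[of "s *s y" x0] by (simp add: norm_vector_mult)
      also have "\<dots> \<le> (1 + norm x0 + norm y) * (1 + norm s)"
        by (simp add: algebra_simps)
      finally have "(1 + norm (s *s y + x0)) ^ i \<le> ((1 + norm x0 + norm y) * (1 + norm s)) ^ i"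
        by (intro power_mono) auto
      then have "K * (1 + norm (s *s y + x0)) ^ i * norm (poly ?a s) \<le>
          K * ((1 + norm x0 + norm y) * (1 + norm s)) ^ i * norm (poly ?a s)"
        using K by (intro mult_right_mono mult_left_mono) auto
      then show ?thesis using bd[of "s *s y + x0"] unfolding ev
        by (simp add: power_mult_distrib mult_ac)
    qed
    ultimately obtain g where g: "?b = ?a * g" "degree g \<le> i"
      using divides_of_growth by blast
    \<comment> \<open>Comparing coefficients in \<open>?b = ?a * g\<close> reproduces the recursion
      of \<open>quotient_component\<close>. So the quotients on the various lines fit together into
      functions polynomial in \<open>y\<close>.\<close>
    have "coeff g j = ?Q j y" for j
    proof (induction j rule: less_induct)
      case (less j)
      have "B j y = (\<Sum>i\<le>j. coeff g i * A (j - i) y)"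
        using arg_cong[OF g(1), of "\<lambda>p. coeff p j"] unfolding c
        by (subst (asm) mult.commute) (simp add: coeff_mult c)
      also have "\<dots> = (\<Sum>i<j. ?Q i y * A (j - i) y) + coeff g j * A 0 y"
        using less by (simp flip: lessThan_Suc_atMost)
      finally show ?case using A0 x0 by (simp add: quotient_component.simps[of A B j] field_simps)
    qed
    then have "poly g 1 = (\<Sum>j\<le>i. ?Q j y)" using poly_eq_sum_coeff[OF g(2), of 1] by simp
    moreover have "poly ?b 1 = poly ?a 1 * poly g 1" by (subst g(1)) simp
    ultimately show ?thesis unfolding ev by simp
  qed
  show ?thesis
  proof
    show "polyf i (\<lambda>x. \<Sum>j\<le>i. ?Q j (x + (- x0)))"
      by (intro polyf_sum polyf_translate polyf.mono[OF Q]) auto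
    show "b x = a x * (\<Sum>j\<le>i. ?Q j (x + (- x0)))" for x using main[of "x - x0"] by simp
  qed
qed

section \<open>Lifting generic zeros along linear projections\<close>

definition polyfuns :: "(complex ^ 'n::finite \<Rightarrow> complex) set" where
  "polyfuns = {f. \<exists>d. polyf d f}"

lemma polyfunsI: "polyf d f \<Longrightarrow> f \<in> polyfuns"
  by (auto simp: polyfuns_def)

lemma subring_polyfuns: "subring_set polyfuns"
  unfolding subring_set_def
proof (intro conjI ballI)
  show "1 \<in> (polyfuns :: (complex ^ 'n \<Rightarrow> complex) set)"
    by (auto simp: one_fun_def intro: polyfunsI polyf_const)
  fix a b :: "complex ^ 'n \<Rightarrow> complex" assume "a \<in> polyfuns" "b \<in> polyfuns"
  then obtain d e where ab: "polyf d a" "polyf e b" by (auto simp: polyfuns_def)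
  have "polyf (max d e) (\<lambda>x. a x - b x)"
    by (intro polyf_diff polyf.mono[OF ab(1)] polyf.mono[OF ab(2)]) auto
  then show "a - b \<in> polyfuns" by (auto simp: fun_diff_def intro: polyfunsI)
  show "a * b \<in> polyfuns" using polyf.mult[OF ab] by (auto simp: times_fun_def intro: polyfunsI)
qed

definition eval_coeffs :: "'a \<Rightarrow> ('a \<Rightarrow> complex) poly \<Rightarrow> complex poly" where
  "eval_coeffs x G = map_poly (\<lambda>f. f x) G"

lemma coeff_eval_coeffs [simp]: "coeff (eval_coeffs x G) i = coeff G i x"
  by (simp add: eval_coeffs_def coeff_map_poly)

lemma degree_eval_coeffs: "lead_coeff G x \<noteq> 0 \<Longrightarrow> degree (eval_coeffs x G) = degree G"
  by (intro antisym degree_le le_degree) (auto simp: coeff_eq_0)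

lemma poly_fun_apply: "poly G t x = poly (eval_coeffs x G) (t x)"
  by (induction G) (auto simp: eval_coeffs_def map_poly_pCons)

lemma power_fun_apply: "(f ^ n) x = (f x) ^ n" for f :: "'a \<Rightarrow> complex"
  by (induction n) auto

text \<open>A projection is an idempotent map of the whole space into itself, so that projections
  with images of different dimension share one type and induction on the kernel is possible.\<close>

definition cproj :: "(complex ^ 'n \<Rightarrow> complex ^ 'n) \<Rightarrow> bool" where
  "cproj p \<longleftrightarrow> clinear_map p \<and> (\<forall>x. p (p x) = p x)"

lemma cprojD:
  assumes "cproj p"
  shows "p (x + y) = p x + p y" "p (c *s x) = c *s p x" "p (p x) = p x" "p 0 = 0" "p (x - y) = p x - p y"
proof -
  show a: "\<And>x y. p (x + y) = p x + p y" and c: "\<And>x c. p (c *s x) = c *s p x" and "p (p x) = p x"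
    using assms by (auto simp: cproj_def clinear_map_def)
  show "p 0 = 0" using c[of 0 0] by simp
  show "p (x - y) = p x - p y" using a[of "x - y" y] by simp
qed

text \<open>Since a projection is idempotent, these are exactly the polynomials in the coordinates
  of \<open>p x\<close>.\<close>

definition inv_ring :: "(complex ^ 'n::finite \<Rightarrow> complex ^ 'n) \<Rightarrow> (complex ^ 'n \<Rightarrow> complex) set" where
  "inv_ring p = {f \<in> polyfuns. \<forall>x. f (p x) = f x}"

lemma subring_inv_ring: "subring_set (inv_ring p)"
  using subring_setD[OF subring_polyfuns] by (auto simp: subring_set_def inv_ring_def)

text \<open>
  The zero set of the contraction of \<open>P\<close> to the polynomials in \<open>p x\<close>, that is, the Zariski closure of
  the image under \<open>p\<close> of the zero set of \<open>P\<close>.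
\<close>

definition proj_zeros ::
    "(complex ^ 'n::finite \<Rightarrow> complex) set \<Rightarrow> (complex ^ 'n \<Rightarrow> complex ^ 'n) \<Rightarrow> (complex ^ 'n) set" where
  "proj_zeros P p = {y. p y = y \<and> (\<forall>f\<in>P \<inter> inv_ring p. f y = 0)}"

text \<open>This restores one lost dimension: for \<open>p e = 0\<close>, \<open>l e = 1\<close> and
  \<open>l\<close> zero on the image of \<open>p\<close>, it is a projection equivalent to the pair
  (\<open>p x\<close>, \<open>l x\<close>).\<close>

definition ext_proj :: "(complex ^ 'n \<Rightarrow> complex ^ 'n) \<Rightarrow> (complex ^ 'n \<Rightarrow> complex) \<Rightarrow> complex ^ 'n \<Rightarrow>
    complex ^ 'n \<Rightarrow> complex ^ 'n" where
  "ext_proj p l e x = p x + l x *s e"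

lemma dual_form_exists:
  assumes p: "cproj p" and e: "p e = 0" "e \<noteq> 0"
  obtains l where "clinear_form l" "l e = 1" "\<And>x. l (p x) = 0"
proof -
  obtain i where i: "e $ i \<noteq> 0" using e by (auto simp: vec_eq_iff)
  show ?thesis
    by (rule that[of "\<lambda>x. (x - p x) $ i / e $ i"])
      (use i e in \<open>auto simp: clinear_form_def cprojD[OF p] algebra_simps add_divide_distrib diff_divide_distrib\<close>)
qed

locale projection_extension =
  fixes P :: "(complex ^ 'n::finite \<Rightarrow> complex) set" and p :: "complex ^ 'n \<Rightarrow> complex ^ 'n"
    and l :: "complex ^ 'n \<Rightarrow> complex" and e :: "complex ^ 'n"
  assumes prime: "prime_ideal_of polyfuns P" and proj: "cproj p" and pe: "p e = 0"
    and l: "clinear_form l" and le: "l e = 1" and lp: "\<And>x. l (p x) = 0"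
begin

abbreviation "p' \<equiv> ext_proj p l e"

lemma l_simps: "l (x + y) = l x + l y" "l (c *s x) = c * l x"
  using l by (auto simp: clinear_form_def)

lemma p'_apply: "p' x = p x + l x *s e"
  by (simp add: ext_proj_def)

lemma cproj_p': "cproj p'"
  unfolding cproj_def clinear_map_def
  by (simp add: p'_apply cprojD[OF proj] l_simps le lp pe vector_add_ldistrib vector_sadd_rdistrib algebra_simps)

lemma p_p': "p (p' x) = p x" and l_p': "l (p' x) = l x"
  by (auto simp: p'_apply cprojD[OF proj] pe l_simps le lp)

lemma kernel_p': "p' x = 0 \<longleftrightarrow> p x = 0 \<and> l x = 0"
proof
  assume "p' x = 0"
  then show "p x = 0 \<and> l x = 0" using p_p'[of x] l_p'[of x] cprojD(4)[OF proj] lp[of 0] by simp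
qed (simp add: p'_apply)

lemma fibre: "p y = y \<Longrightarrow> p (y + T *s e) = y" "p y = y \<Longrightarrow> l (y + T *s e) = T"
  "p y = y \<Longrightarrow> p' (y + T *s e) = y + T *s e"
  using lp[of y] by (auto simp: p'_apply cprojD[OF proj] pe l_simps le)

lemma l_inv_ring: "l \<in> inv_ring p'"
  using polyf_clinear_form[OF l] by (auto simp: inv_ring_def l_p' intro: polyfunsI)

lemma inv_ring_subset: "inv_ring p \<subseteq> inv_ring p'"
proof
  fix f assume f: "f \<in> inv_ring p"
  then have "f (p' x) = f x" for x unfolding inv_ring_def using p_p' by (metis (mono_tags, lifting) mem_Collect_eq)
  then show "f \<in> inv_ring p'" using f by (simp add: inv_ring_def)
qed

text \<open>The preceding algebra now applies to the new coordinate \<open>l\<close> over the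
  polynomials in \<open>p x\<close>.\<close>

sublocale prime_extension polyfuns P "inv_ring p" l
  using prime subring_polyfuns subring_inv_ring polyf_clinear_form[OF l]
  by unfold_locales (auto simp: inv_ring_def intro: polyfunsI)

lemma poly_in_inv_ring: "G \<in> polys_over (inv_ring p) \<Longrightarrow> poly G l \<in> inv_ring p'"
  by (rule polys_over_poly[OF subring_inv_ring inv_ring_subset l_inv_ring])

text \<open>Such an \<open>f\<close> satisfies f(x) = f(\<open>p x + l x *s e\<close>), and each
  coordinate of that vector is linear in \<open>l\<close> with coefficients in
  \<open>inv_ring p\<close>.\<close>

lemma inv_ring_p'_as_poly:
  assumes f: "f \<in> inv_ring p'"
  obtains G where "G \<in> polys_over (inv_ring p)" "f = poly G l"
proof -
  note PS = polys_over_arith[OF subring_inv_ring]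
  have C: "(\<lambda>_. c) \<in> inv_ring p" for c by (auto simp: inv_ring_def intro: polyfunsI polyf_const)
  have ex: "\<exists>G\<in>polys_over (inv_ring p). \<forall>x. poly G l x = f (p' x)" if "polyf d f" for d f
    using that
  proof (induction rule: polyf.induct)
    case (const c)
    show ?case by (rule bexI[of _ "[:\<lambda>_. c:]"]) (simp, intro PS(1,8) C)
  next
    case (coord i)
    have "(\<lambda>x. p x $ i) \<in> inv_ring p"
      using polyf_comp[OF polyf.coord, of p] proj by (auto simp: inv_ring_def cproj_def intro: polyfunsI)
    then have "[:\<lambda>x. p x $ i, \<lambda>_. e $ i:] \<in> polys_over (inv_ring p)"
      by (intro PS(1,8) C)
    then show ?case by (rule bexI[rotated]) (simp add: p'_apply)
  next
    case (mono d f e')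
    show ?case by (rule mono)
  next
    case (add d f g)
    obtain G H where G: "G \<in> polys_over (inv_ring p)" "\<forall>x. poly G l x = f (p' x)"
      and H: "H \<in> polys_over (inv_ring p)" "\<forall>x. poly H l x = g (p' x)" using add.IH by blast
    show ?case by (rule bexI[OF _ PS(3)[OF G(1) H(1)]]) (simp add: G H)
  next
    case (mult d f e' g)
    obtain G H where G: "G \<in> polys_over (inv_ring p)" "\<forall>x. poly G l x = f (p' x)"
      and H: "H \<in> polys_over (inv_ring p)" "\<forall>x. poly H l x = g (p' x)" using mult.IH by blast
    show ?case by (rule bexI[OF _ PS(5)[OF G(1) H(1)]]) (simp add: G H)
  qed
  obtain d where "polyf d f" using f by (auto simp: inv_ring_def polyfuns_def)
  then obtain G where G: "G \<in> polys_over (inv_ring p)" "\<forall>x. poly G l x = f (p' x)" using ex by blast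
  have "f = poly G l" using G(2) f by (intro ext) (simp add: inv_ring_def)
  then show ?thesis using that G(1) by blast
qed

lemma eval_coeffs_fibre:
  assumes "G \<in> polys_over (inv_ring p)" "p y = y"
  shows "eval_coeffs (y + T *s e) G = eval_coeffs y G"
proof (rule poly_eqI)
  fix i
  have "coeff G i (p (y + T *s e)) = coeff G i (y + T *s e)"
    using assms polys_over_coeff[of G "inv_ring p" i] by (auto simp: inv_ring_def)
  then show "coeff (eval_coeffs (y + T *s e) G) i = coeff (eval_coeffs y G) i"
    by (simp add: fibre assms)
qed

lemma poly_fibre:
  assumes "G \<in> polys_over (inv_ring p)" "p y = y"
  shows "poly G l (y + T *s e) = poly (eval_coeffs y G) T"
  by (simp add: poly_fun_apply eval_coeffs_fibre assms fibre)

lemma vanishing_fibre: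
  assumes "G \<in> polys_over (inv_ring p)" "\<And>i. coeff G i \<in> P" "y \<in> proj_zeros P p"
  shows "eval_coeffs y G = 0"
  using assms polys_over_coeff[OF assms(1)] by (intro poly_eqI) (auto simp: proj_zeros_def)

text \<open>The polynomial sought is a product of two factors. Where \<open>lead_coeff F\<close> is
  nonzero, a root of \<open>F\<close> over \<open>y\<close> is a zero of every \<open>f\<close> in
  \<open>P\<close> invariant under \<open>p'\<close>, since a power of \<open>lead_coeff F\<close>
  times \<open>f\<close> is a multiple of \<open>F\<close> up to coefficients in \<open>P\<close>.
  The other factor is a multiple of \<open>g\<close> modulo \<open>P\<close>, so \<open>g\<close>
  cannot vanish where that factor does not.\<close>

lemma lift_algebraic:
  assumes F: "relation_pol F" and g: "g \<in> inv_ring p'" "g \<notin> P"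
  obtains c where "c \<in> inv_ring p" "c \<notin> P"
    "\<And>y. y \<in> proj_zeros P p \<Longrightarrow> c y \<noteq> 0 \<Longrightarrow> lead_coeff F y \<noteq> 0"
    "\<And>y T. y \<in> proj_zeros P p \<Longrightarrow> c y \<noteq> 0 \<Longrightarrow> poly (eval_coeffs y F) T = 0 \<Longrightarrow>
       y + T *s e \<in> proj_zeros P p' \<and> g (y + T *s e) \<noteq> 0"
proof -
  have FS: "F \<in> polys_over (inv_ring p)" "lead_coeff F \<notin> P" "lead_coeff F \<in> inv_ring p"
    using F by (auto simp: relation_pol_def polys_over_def)
  obtain G where G: "G \<in> polys_over (inv_ring p)" "g = poly G l"
    using inv_ring_p'_as_poly[OF g(1)] .
  obtain W c where W: "W \<in> polys_over (inv_ring p)" "c \<in> inv_ring p" "c \<notin> P"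
    "poly W l * poly G l - c \<in> P"
    using relation_pol_inverse[OF F G(1)] g G by metis
  show ?thesis
  proof (rule that[of "c * lead_coeff F"])
    show "c * lead_coeff F \<in> inv_ring p" using subring_setD(4)[OF subring_inv_ring] W FS by blast
    show "c * lead_coeff F \<notin> P" using prime_P[of c "lead_coeff F"] W FS SA by blast
    show "lead_coeff F y \<noteq> 0" if "(c * lead_coeff F) y \<noteq> 0" for y using that by simp
    fix y T assume y: "y \<in> proj_zeros P p" and c: "(c * lead_coeff F) y \<noteq> 0"
      and T: "poly (eval_coeffs y F) T = 0"
    have py: "p y = y" using y by (simp add: proj_zeros_def)
    have z: "f (y + T *s e) = 0" if f: "f \<in> P" "f \<in> inv_ring p'" for f
    proof -
      obtain H where H: "H \<in> polys_over (inv_ring p)" "f = poly H l"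
        using inv_ring_p'_as_poly[OF f(2)] .
      obtain N Q R where *: "smult (lead_coeff F ^ N) H = Q * F + R" "R \<in> polys_over (inv_ring p)"
          "\<And>i. coeff R i \<in> P"
        using relation_pol_divides[OF F H(1)] H(2) f(1) by metis
      have "lead_coeff F ^ N * f = poly Q l * poly F l + poly R l"
        using arg_cong[OF *(1), of "\<lambda>p. poly p l"] by (simp add: H)
      from fun_cong[OF this, of "y + T *s e"]
      have "lead_coeff F (y + T *s e) ^ N * f (y + T *s e) = 0"
        by (simp add: poly_fibre py FS * T vanishing_fibre[OF *(2,3) y] power_fun_apply)
      moreover have "lead_coeff F (p (y + T *s e)) = lead_coeff F (y + T *s e)"
        using FS by (simp add: inv_ring_def)
      ultimately show ?thesis using c by (simp add: fibre py)
    qed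
    have "poly W l * poly G l - c \<in> inv_ring p'"
      using inv_ring_subset W G by (intro subring_setD(3,4)[OF subring_inv_ring] poly_in_inv_ring) auto
    from z[OF W(4) this] have "poly W l (y + T *s e) * g (y + T *s e) = c (y + T *s e)"
      by (simp add: G)
    moreover have "c (p (y + T *s e)) = c (y + T *s e)" using W by (simp add: inv_ring_def)
    ultimately have "g (y + T *s e) \<noteq> 0" using c by (auto simp: fibre py)
    then show "y + T *s e \<in> proj_zeros P p' \<and> g (y + T *s e) \<noteq> 0"
      using z by (auto simp: proj_zeros_def fibre py)
  qed
qed

text \<open>Without a relation, members of \<open>P\<close> have all their coefficients in
  \<open>P\<close>, so the whole line over \<open>y\<close> consists of zeros. Some coefficient of
  \<open>g\<close> lies outside \<open>P\<close>; where it is nonzero, \<open>g\<close> excludes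
  only finitely many \<open>T\<close>.\<close>

lemma lift_transcendental:
  assumes F: "\<nexists>F. relation_pol F" and g: "g \<in> inv_ring p'" "g \<notin> P"
  obtains c where "c \<in> inv_ring p" "c \<notin> P"
    "\<And>y. y \<in> proj_zeros P p \<Longrightarrow> c y \<noteq> 0 \<Longrightarrow>
       finite {T. \<not> (y + T *s e \<in> proj_zeros P p' \<and> g (y + T *s e) \<noteq> 0)}"
proof -
  obtain G where G: "G \<in> polys_over (inv_ring p)" "g = poly G l"
    using inv_ring_p'_as_poly[OF g(1)] .
  have "\<exists>i. coeff G i \<notin> P"
  proof (rule ccontr)
    assume "\<not> ?thesis"
    then have "poly G l \<in> P"
      unfolding poly_altdef
      by (intro ideal_of_sum[OF ideal_P A] Pcl(5) subring_set_power[OF A tA]) auto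
    then show False using G g by blast
  qed
  then obtain i where i: "coeff G i \<notin> P" ..
  show ?thesis
  proof (rule that[of "coeff G i"])
    show "coeff G i \<in> inv_ring p" using G by (simp add: polys_over_def)
    fix y assume y: "y \<in> proj_zeros P p" and c: "coeff G i y \<noteq> 0"
    have py: "p y = y" using y by (simp add: proj_zeros_def)
    have "f (y + T *s e) = 0" if f: "f \<in> P" "f \<in> inv_ring p'" for f T
    proof -
      obtain H where H: "H \<in> polys_over (inv_ring p)" "f = poly H l"
        using inv_ring_p'_as_poly[OF f(2)] .
      have "coeff H i \<in> P" for i using F relation_pol_exists[OF H(1)] f H by metis
      then show ?thesis using vanishing_fibre[OF H(1) _ y] by (simp add: H poly_fibre py)
    qed
    then have "{T. \<not> (y + T *s e \<in> proj_zeros P p' \<and> g (y + T *s e) \<noteq> 0)} \<subseteq>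
        {T. poly (eval_coeffs y G) T = 0}"
      by (auto simp: proj_zeros_def fibre py G poly_fibre)
    moreover have "eval_coeffs y G \<noteq> 0" using c by (metis coeff_eval_coeffs coeff_0)
    ultimately show "finite {T. \<not> (y + T *s e \<in> proj_zeros P p' \<and> g (y + T *s e) \<noteq> 0)}"
      using poly_roots_finite finite_subset by blast
  qed (rule i)
qed

lemma lift_one:
  assumes g: "g \<in> inv_ring p'" "g \<notin> P"
  obtains c where "c \<in> inv_ring p" "c \<notin> P"
    "\<And>y. y \<in> proj_zeros P p \<Longrightarrow> c y \<noteq> 0 \<Longrightarrow> \<exists>T. y + T *s e \<in> proj_zeros P p' \<and> g (y + T *s e) \<noteq> 0"
proof (cases "\<exists>F. relation_pol F")
  case True
  then obtain F where F: "relation_pol F" ..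
  obtain c where c: "c \<in> inv_ring p" "c \<notin> P"
    "\<And>y. y \<in> proj_zeros P p \<Longrightarrow> c y \<noteq> 0 \<Longrightarrow> lead_coeff F y \<noteq> 0"
    "\<And>y T. y \<in> proj_zeros P p \<Longrightarrow> c y \<noteq> 0 \<Longrightarrow> poly (eval_coeffs y F) T = 0 \<Longrightarrow>
       y + T *s e \<in> proj_zeros P p' \<and> g (y + T *s e) \<noteq> 0"
    using lift_algebraic[OF F g] by blast
  have "\<exists>T. y + T *s e \<in> proj_zeros P p' \<and> g (y + T *s e) \<noteq> 0"
    if y: "y \<in> proj_zeros P p" "c y \<noteq> 0" for y
  proof -
    have "\<not> constant (poly (eval_coeffs y F))"
      using degree_eval_coeffs[OF c(3)[OF y]] relation_pol_degree_pos[OF F] by (simp add: constant_degree)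
    then show ?thesis using c(4)[OF y] fundamental_theorem_of_algebra by blast
  qed
  then show ?thesis using that c by blast
next
  case False
  obtain c where c: "c \<in> inv_ring p" "c \<notin> P"
    "\<And>y. y \<in> proj_zeros P p \<Longrightarrow> c y \<noteq> 0 \<Longrightarrow>
       finite {T. \<not> (y + T *s e \<in> proj_zeros P p' \<and> g (y + T *s e) \<noteq> 0)}"
    using lift_transcendental[OF False g] by blast
  have "\<exists>T. y + T *s e \<in> proj_zeros P p' \<and> g (y + T *s e) \<noteq> 0"
    if y: "y \<in> proj_zeros P p" "c y \<noteq> 0" for y
    using ex_new_if_finite[OF infinite_UNIV_char_0 c(3)[OF y]] by blast
  then show ?thesis using that c by blast
qed

end

section \<open>Lifting through a chain of projections with shrinking kernels\<close>

lemma dim_kernel_less: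
  assumes p: "cproj p" and q: "cproj q" and sub: "\<And>x. q x = 0 \<Longrightarrow> p x = 0"
    and e: "p e = 0" "q e \<noteq> 0"
  shows "dim {x. q x = 0} < dim {x. p x = 0}"
proof -
  have s: "subspace {x. p x = 0}" if "cproj p" for p :: "complex ^ 'n \<Rightarrow> complex ^ 'n"
  proof (rule subspaceI)
    fix c :: real and x assume "x \<in> {x. p x = 0}"
    then show "c *\<^sub>R x \<in> {x. p x = 0}" by (simp add: scaleR_eq_vector_mult cprojD[OF that])
  qed (auto simp: cprojD[OF that])
  show ?thesis
  proof (rule dim_psubset)
    have "{x. q x = 0} \<subset> {x. p x = 0}" using sub e by blast
    then show "span {x. q x = 0} \<subset> span {x. p x = 0}"
      using s[OF p] s[OF q] by (simp add: span_eq_iff[THEN iffD2])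
  qed
qed

text \<open>Each step lifts \<open>y\<close> along one kernel direction, to a point where the
  polynomial \<open>g\<close> belonging to the smaller kernel is nonzero, so that lifting can
  continue. With trivial kernel \<open>p\<close> is the identity and \<open>proj_zeros P p\<close>
  is the zero set of \<open>P\<close>.\<close>

lemma lift_generic:
  fixes p :: "complex ^ 'n::finite \<Rightarrow> complex ^ 'n"
  assumes P: "prime_ideal_of polyfuns P" and p: "cproj p"
  shows "\<exists>g\<in>inv_ring p - P. \<forall>y\<in>proj_zeros P p. g y \<noteq> 0 \<longrightarrow> (\<exists>x. p x = y \<and> (\<forall>f\<in>P. f x = 0))"
  using p
proof (induction "dim {x. p x = 0}" arbitrary: p rule: less_induct)
  case less
  note p = less.prems
  show ?case
  proof (cases "\<forall>x. p x = 0 \<longrightarrow> x = 0")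
    case True
    have "p x = x" for x using True cprojD[OF p] by (metis eq_iff_diff_eq_0)
    moreover have "P \<subseteq> polyfuns" using P by (simp add: prime_ideal_of_def ideal_of_def)
    ultimately show ?thesis
      using P subring_setD(1)[OF subring_inv_ring]
      by (intro bexI[of _ 1]) (auto simp: proj_zeros_def inv_ring_def prime_ideal_of_def)
  next
    case False
    then obtain e where e: "p e = 0" "e \<noteq> 0" by blast
    obtain l where l: "clinear_form l" "l e = 1" "\<And>x. l (p x) = 0"
      using dual_form_exists[OF p e] by blast
    interpret projection_extension P p l e
      using P p e l by unfold_locales
    have "dim {x. p' x = 0} < dim {x. p x = 0}"
      by (rule dim_kernel_less[of _ _ e]) (use p cproj_p' kernel_p' e le in auto)
    from less.hyps[OF this cproj_p'] obtain g where
      g: "g \<in> inv_ring p'" "g \<notin> P" "\<And>y. y \<in> proj_zeros P p' \<Longrightarrow> g y \<noteq> 0 \<Longrightarrow> \<exists>x. p' x = y \<and> (\<forall>f\<in>P. f x = 0)"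
      by blast
    obtain c where c: "c \<in> inv_ring p" "c \<notin> P"
      "\<And>y. y \<in> proj_zeros P p \<Longrightarrow> c y \<noteq> 0 \<Longrightarrow> \<exists>T. y + T *s e \<in> proj_zeros P p' \<and> g (y + T *s e) \<noteq> 0"
      using lift_one[OF g(1,2)] by blast
    show ?thesis
    proof (intro bexI[of _ c] ballI impI)
      fix y assume y: "y \<in> proj_zeros P p" "c y \<noteq> 0"
      obtain T x where "p' x = y + T *s e" "\<forall>f\<in>P. f x = 0"
        using c(3)[OF y] g(3) by blast
      moreover have "p y = y" using y by (simp add: proj_zeros_def)
      ultimately show "\<exists>x. p x = y \<and> (\<forall>f\<in>P. f x = 0)" using p_p'[of x] fibre(1) by metis
    qed (use c in auto)
  qed
qed

section \<open>Polynomial functions and polynomials\<close>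

lemma poly_value_hom_component:
  "poly_value (hom_component d f) x =
     (\<Sum>m | m \<in> Poly_Mapping.keys f \<and> monom_degree m = d. Poly_Mapping.lookup f m * monom_value m x)"
  by (simp add: hom_component_def poly_value_sum poly_value_single)

lemma monom_value_scale: "monom_value m (s *s x) = s ^ monom_degree m * monom_value m x"
  by (simp add: monom_value_def monom_degree_def power_mult_distrib prod.distrib power_sum)

lemma poly_value_hom_component_scale:
  "poly_value (hom_component d f) (s *s x) = s ^ d * poly_value (hom_component d f) x"
  unfolding poly_value_hom_component sum_distrib_left
  by (intro sum.cong) (auto simp: monom_value_scale)

lemma polyf_prod:
  "finite I \<Longrightarrow> (\<And>i. i \<in> I \<Longrightarrow> polyf (d i) (f i)) \<Longrightarrow> polyf (sum d I) (\<lambda>x. \<Prod>i\<in>I. f i x)"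
  by (induction I rule: finite_induct) (auto intro: polyf_const polyf.mult)

lemma polyf_monom_value: "polyf (monom_degree m) (monom_value m)"
proof -
  have "polyf (Poly_Mapping.lookup m i) (\<lambda>x. (x $ i) ^ Poly_Mapping.lookup m i)" for i
    using polyf_power[OF polyf.coord] by simp
  then have "polyf (monom_degree m) (\<lambda>x. \<Prod>i\<in>UNIV. (x $ i) ^ Poly_Mapping.lookup m i)"
    unfolding monom_degree_def by (intro polyf_prod) auto
  then show ?thesis by (simp add: monom_value_def[abs_def])
qed

lemma polyf_hom_component: "polyf d (poly_value (hom_component d f))"
proof -
  have "polyf d (\<lambda>x. \<Sum>m | m \<in> Poly_Mapping.keys f \<and> monom_degree m = d.
      Poly_Mapping.lookup f m * monom_value m x)"
    by (intro polyf_sum polyf_cmult) (use polyf_monom_value in auto)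
  then show ?thesis by (simp add: poly_value_hom_component[abs_def])
qed

lemma poly_value_eq_sum_hom_component:
  "poly_value f x = (\<Sum>d\<le>total_degree f. poly_value (hom_component d f) x)"
proof -
  have "monom_degree ` Poly_Mapping.keys f \<subseteq> {..total_degree f}"
    by (auto simp: total_degree_def)
  then have "(\<Sum>d\<le>total_degree f. \<Sum>m\<in>{m \<in> Poly_Mapping.keys f. monom_degree m = d}.
      Poly_Mapping.lookup f m * monom_value m x) = poly_value f x"
    unfolding poly_value_def by (intro sum.group) auto
  then show ?thesis by (simp add: poly_value_hom_component)
qed

lemma polyf_poly_value: "polyf (total_degree f) (poly_value f)"
proof -
  have "polyf (total_degree f) (\<lambda>x. \<Sum>d\<le>total_degree f. poly_value (hom_component d f) x)"
    by (intro polyf_sum polyf.mono[OF polyf_hom_component]) auto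
  then show ?thesis by (simp flip: poly_value_eq_sum_hom_component)
qed

lemma polyf_representation:
  fixes g :: "complex ^ 'n::finite \<Rightarrow> complex"
  assumes "polyf d g"
  obtains f where "poly_value f = g" "total_degree f \<le> d"
proof -
  have "\<exists>f. (\<forall>x. poly_value f x = g x) \<and> (\<forall>m\<in>Poly_Mapping.keys f. monom_degree m \<le> d)"
    using assms
  proof (induction rule: polyf.induct)
    case (const c)
    have "poly_value (Poly_Mapping.single 0 c) x = c" for x :: "complex ^ 'n"
      by (simp add: poly_value_single monom_value_def)
    moreover have "\<forall>m\<in>Poly_Mapping.keys (Poly_Mapping.single 0 c). monom_degree m \<le> 0"
      by (simp add: monom_degree_def)
    ultimately show ?case by blast
  next
    case (coord i)
    have "monom_degree (Poly_Mapping.single i 1) = (\<Sum>j\<in>UNIV. if j = i then 1 else 0)"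
      unfolding monom_degree_def by (intro sum.cong) (auto simp: lookup_single when_def)
    then have "\<forall>m\<in>Poly_Mapping.keys (Poly_Mapping.single (Poly_Mapping.single i (1::nat)) (1::complex)).
        monom_degree m \<le> 1"
      by simp
    then show ?case using poly_value_variable[of i] by blast
  next
    case (mono d f e)
    obtain a where a: "\<forall>x. poly_value a x = f x" "\<forall>m\<in>Poly_Mapping.keys a. monom_degree m \<le> d"
      using mono.IH by (elim exE conjE)
    have "\<forall>m\<in>Poly_Mapping.keys a. monom_degree m \<le> e" using a(2) mono.hyps(2) by (meson order.trans)
    then show ?case using a(1) by (intro exI conjI)
  next
    case (add d g h)
    obtain a b where ab: "\<forall>x. poly_value a x = g x" "\<forall>m\<in>Poly_Mapping.keys a. monom_degree m \<le> d"
      "\<forall>x. poly_value b x = h x" "\<forall>m\<in>Poly_Mapping.keys b. monom_degree m \<le> d"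
      using add.IH by (elim exE conjE)
    have "\<forall>x. poly_value (a + b) x = g x + h x" using ab by (simp add: poly_value_add)
    moreover have "\<forall>m\<in>Poly_Mapping.keys (a + b). monom_degree m \<le> d"
      using Poly_Mapping.keys_add[of a b] ab(2,4) by blast
    ultimately show ?case by (intro exI conjI)
  next
    case (mult d g e h)
    obtain a b where ab: "\<forall>x. poly_value a x = g x" "\<forall>m\<in>Poly_Mapping.keys a. monom_degree m \<le> d"
      "\<forall>x. poly_value b x = h x" "\<forall>m\<in>Poly_Mapping.keys b. monom_degree m \<le> e"
      using mult.IH by (elim exE conjE)
    have "monom_degree m \<le> d + e" if m: "m \<in> Poly_Mapping.keys (a * b)" for m
    proof -
      obtain k l where "m = k + l" "k \<in> Poly_Mapping.keys a" "l \<in> Poly_Mapping.keys b"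
        using m keys_mult[of a b] by blast
      moreover have "monom_degree (k + l) = monom_degree k + monom_degree l"
        by (simp add: monom_degree_def lookup_add sum.distrib)
      ultimately show ?thesis using ab(2,4) by (simp add: add_mono)
    qed
    moreover have "\<forall>x. poly_value (a * b) x = g x * h x" using ab by (simp add: poly_value_mult)
    ultimately show ?case by blast
  qed
  then obtain f where "poly_value f = g" "\<forall>m\<in>Poly_Mapping.keys f. monom_degree m \<le> d" by (auto simp: fun_eq_iff)
  then show ?thesis using that[of f] by (auto simp: total_degree_def)
qed

section \<open>Limit directions at infinity\<close>

lemma clinear_map_linear: "clinear_map p \<Longrightarrow> linear p"
  by (rule linearI) (auto simp: clinear_map_def scaleR_eq_vector_mult)

lemma clinear_form_linear: "clinear_form l \<Longrightarrow> linear l"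
  by (rule linearI) (auto simp: clinear_form_def scaleR_eq_vector_mult scaleR_conv_of_real)

lemma polyf_tendsto: "polyf d f \<Longrightarrow> (X \<longlongrightarrow> a) F \<Longrightarrow> ((\<lambda>k. f (X k)) \<longlongrightarrow> f a) F"
  by (induction rule: polyf.induct) (auto intro!: tendsto_intros)

definition asymptotic_direction :: "(complex ^ 'n) set \<Rightarrow> complex ^ 'n \<Rightarrow> bool" where
  "asymptotic_direction W v \<longleftrightarrow> (\<exists>(x :: nat \<Rightarrow> complex ^ 'n) (t :: nat \<Rightarrow> complex).
     (\<forall>k. x k \<in> W) \<and> filterlim (\<lambda>k. norm (x k)) at_top sequentially \<and> (\<lambda>k. t k *s x k) \<longlonglongrightarrow> v)"

lemma asymptotic_direction_scale:
  assumes "asymptotic_direction W v" shows "asymptotic_direction W (c *s v)"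
proof -
  obtain x t where x: "\<forall>k. x k \<in> W" "filterlim (\<lambda>k. norm (x k)) at_top sequentially"
    "(\<lambda>k. t k *s x k) \<longlonglongrightarrow> v" using assms unfolding asymptotic_direction_def by blast
  have "(\<lambda>k. c *s (t k *s x k)) \<longlonglongrightarrow> c *s v"
    using tendsto_vec_nth[OF x(3)] by (intro vec_tendstoI) (auto simp: mult.assoc intro: tendsto_mult_left)
  then show ?thesis using x unfolding asymptotic_direction_def
    by (intro exI[of _ x] exI[of _ "\<lambda>k. c * t k"]) (auto simp: vector_smult_assoc)
qed

lemma top_component_vanishes:
  assumes h: "\<And>j. polyf j (h j)" "\<And>j s x. h j (s *s x) = s ^ j * h j x"
    and W: "\<And>x. x \<in> W \<Longrightarrow> (\<Sum>j\<le>d. h j x) = 0" and v: "asymptotic_direction W v"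
  shows "h d v = 0"
proof -
  obtain x t where x: "\<And>k. x k \<in> W" "filterlim (\<lambda>k. norm (x k)) at_top sequentially"
    "(\<lambda>k. t k *s x k) \<longlonglongrightarrow> v" using v unfolding asymptotic_direction_def by blast
  \<comment> \<open>The scalars tend to 0, since a convergent sequence is divided by one tending to
    infinity.\<close>
  have "(\<lambda>k. norm (t k *s x k) / norm (x k)) \<longlonglongrightarrow> 0"
    by (rule real_tendsto_divide_at_top[OF tendsto_norm[OF x(3)] x(2)])
  moreover have "\<forall>\<^sub>F k in sequentially. norm (t k *s x k) / norm (x k) = norm (t k)"
    using filterlim_at_top_dense[THEN iffD1, OF x(2), rule_format, of 0]
    by eventually_elim (simp add: norm_vector_mult)
  ultimately have "(\<lambda>k. norm (t k)) \<longlonglongrightarrow> 0" by (rule Lim_transform_eventually)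
  then have t: "t \<longlonglongrightarrow> 0" by (rule tendsto_norm_zero_cancel)
  \<comment> \<open>In the limit \<open>0 ^ (d - j)\<close> is 1 for \<open>j = d\<close> and 0 for
    smaller \<open>j\<close>, so only the top component survives.\<close>
  have "(\<lambda>k. \<Sum>j\<le>d. t k ^ (d - j) * h j (t k *s x k)) \<longlonglongrightarrow> (\<Sum>j\<le>d. 0 ^ (d - j) * h j v)"
    by (intro tendsto_intros polyf_tendsto[OF h(1)] x t)
  moreover have "(\<Sum>j\<le>d. t k ^ (d - j) * h j (t k *s x k)) = t k ^ d * (\<Sum>j\<le>d. h j (x k))" for k
    unfolding sum_distrib_left
    by (intro sum.cong refl) (simp add: h(2) mult.assoc[symmetric] power_add[symmetric])
  ultimately have "(\<lambda>k. 0) \<longlonglongrightarrow> (\<Sum>j\<le>d. 0 ^ (d - j) * h j v)" using W x(1) by simp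
  then have "(\<Sum>j\<le>d. 0 ^ (d - j) * h j v) = 0" using LIMSEQ_unique tendsto_const by blast
  moreover have "(\<Sum>j\<le>d. 0 ^ (d - j) * h j v) = (\<Sum>j\<in>{d}. 0 ^ (d - j) * h j v)"
    by (rule sum.mono_neutral_right) auto
  ultimately show ?thesis by simp
qed

text \<open>If no \<open>K\<close> works, there are points with norm above k (1 + |p x|) for every
  k. Normalised, a subsequence converges to a unit vector that is a direction of \<open>W\<close>
  and is killed by \<open>p\<close>.\<close>

lemma bounded_by_projection:
  assumes p: "clinear_map p" and ker: "\<And>c. asymptotic_direction W c \<Longrightarrow> p c = 0 \<Longrightarrow> c = 0"
  obtains K where "0 \<le> K" "\<And>x. x \<in> W \<Longrightarrow> norm x \<le> K * (1 + norm (p x))"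
proof (rule ccontr)
  assume no: "\<not> thesis"
  have "\<exists>x\<in>W. norm x > real k * (1 + norm (p x))" for k
    using no that[of "real k"] by force
  then obtain x where x: "\<And>k. x k \<in> W" "\<And>k. norm (x k) > real k * (1 + norm (p (x k)))"
    by metis
  have xk: "norm (x k) > real k" "norm (x k) > real k * norm (p (x k))" for k
    using x(2)[of k] mult_nonneg_nonneg[of "real k" "norm (p (x k))"] of_nat_0_le_iff[of k]
      norm_ge_zero[of "p (x k)"] unfolding distrib_left by linarith+
  have lim: "filterlim (\<lambda>k. norm (x k)) at_top sequentially"
    by (rule filterlim_at_top_mono[OF filterlim_real_sequentially]) (intro always_eventually allI less_imp_le xk(1))
  have pos: "norm (x k) > 0" for k by (rule le_less_trans[OF of_nat_0_le_iff xk(1)])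
  define u where "u = (\<lambda>k. complex_of_real (inverse (norm (x k))) *s x k)"
  have nu: "norm (u k) = 1" for k using pos[of k] by (simp add: u_def norm_vector_mult norm_inverse)
  then have "\<forall>k. u k \<in> sphere 0 1" by simp
  then have "\<exists>c\<in>sphere 0 1. \<exists>r. strict_mono r \<and> (u \<circ> r) \<longlonglongrightarrow> c"
    using compact_sphere[of "0 :: complex ^ 'a" 1] unfolding compact_def by blast
  then obtain c r where c: "c \<in> sphere 0 1" "strict_mono r" "(u \<circ> r) \<longlonglongrightarrow> c"
    by blast
  have "p (u k) = complex_of_real (inverse (norm (x k))) *s p (x k)" for k
    using p by (simp add: u_def clinear_map_def)
  then have pu: "norm (p (u k)) = norm (p (x k)) / norm (x k)" for k
    by (simp add: norm_vector_mult norm_inverse divide_inverse mult.commute)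
  have "(\<lambda>k. p (u k)) \<longlonglongrightarrow> 0"
  proof (rule Lim_null_comparison)
    show "\<forall>\<^sub>F k in sequentially. norm (p (u k)) \<le> 1 / real k"
      unfolding pu using xk(2) pos
      by (intro eventually_mono[OF eventually_gt_at_top[of 0]])
        (simp add: field_simps less_imp_le)
    show "(\<lambda>k. 1 / real k) \<longlonglongrightarrow> 0" by (rule lim_1_over_n)
  qed
  then have "(\<lambda>k. p (u (r k))) \<longlonglongrightarrow> 0"
    using LIMSEQ_subseq_LIMSEQ[OF _ c(2)] by (auto simp: o_def)
  moreover have "(\<lambda>k. p (u (r k))) \<longlonglongrightarrow> p c"
    using bounded_linear.tendsto[OF linear_conv_bounded_linear[THEN iffD1, OF clinear_map_linear[OF p]] c(3)]
    by (simp add: o_def)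
  ultimately have "p c = 0" using LIMSEQ_unique by blast
  moreover have "asymptotic_direction W c"
    unfolding asymptotic_direction_def
  proof (intro exI conjI allI)
    show "x (r k) \<in> W" for k by (rule x(1))
    show "filterlim (\<lambda>k. norm (x (r k))) at_top sequentially"
      by (rule filterlim_compose[OF lim filterlim_subseq[OF c(2)]])
    show "(\<lambda>k. complex_of_real (inverse (norm (x (r k)))) *s x (r k)) \<longlonglongrightarrow> c"
      using c(3) by (simp add: u_def o_def)
  qed
  ultimately have "c = 0" using ker by blast
  then show False using c(1) by simp
qed

text \<open>
  If \<open>f\<close> has degree at most \<open>d\<close>, then the coefficient of \<open>s ^ d\<close> in \<open>f (s *s v)\<close> is the value at \<open>v\<close>
  of its component of degree \<open>d\<close>. So these are the \<open>f\<close> whose top form does not vanish at \<open>v\<close>.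
\<close>

definition top_nonvanishing :: "complex ^ 'n::finite \<Rightarrow> (complex ^ 'n \<Rightarrow> complex) set" where
  "top_nonvanishing v = {f. \<exists>d q. polyf d f \<and> (\<forall>s. f (s *s v) = poly q s) \<and> q \<noteq> 0 \<and> degree q = d}"

lemma const_top_nonvanishing: "c \<noteq> 0 \<Longrightarrow> (\<lambda>_. c) \<in> top_nonvanishing v"
  unfolding top_nonvanishing_def by (auto intro!: exI[of _ "[:c:]"] polyf_const)

lemma mult_top_nonvanishing:
  assumes "f \<in> top_nonvanishing v" "g \<in> top_nonvanishing v"
  shows "f * g \<in> top_nonvanishing v"
proof -
  obtain q r where q: "polyf (degree q) f" "\<And>s. f (s *s v) = poly q s" "q \<noteq> 0"
    and r: "polyf (degree r) g" "\<And>s. g (s *s v) = poly r s" "r \<noteq> 0"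
    using assms by (auto simp: top_nonvanishing_def)
  have "polyf (degree (q * r)) (f * g)"
    using polyf.mult[OF q(1) r(1)] q(3) r(3) by (simp add: degree_mult_eq times_fun_def)
  then show ?thesis
    unfolding top_nonvanishing_def using q r by (auto intro!: exI[of _ "q * r"])
qed

text \<open>The component of \<open>q\<close> in its least possible degree is again invariant under
  \<open>p\<close> and vanishes on the directions of \<open>W\<close>. By \<open>surj\<close> their
  images fill the image of \<open>p\<close> up to scalars, so this component is zero, against the
  choice of the degree. Degree 0 escapes the argument; there \<open>q\<close> would be a nonzero
  constant, which lies in \<open>top_nonvanishing v\<close>.\<close>

lemma invariant_relation_trivial:
  fixes p :: "complex ^ 'n::finite \<Rightarrow> complex ^ 'n"
  assumes p: "cproj p" and q: "polyf n q" "\<And>x. q (p x) = q x" "q \<notin> top_nonvanishing v"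
    and W: "\<And>x. x \<in> W \<Longrightarrow> q x = 0"
    and surj: "\<And>w. p w \<noteq> 0 \<Longrightarrow> \<exists>c a. asymptotic_direction W c \<and> a \<noteq> 0 \<and> p c = a *s p w"
  shows "q x = 0"
proof (rule ccontr)
  assume x: "q x \<noteq> 0"
  define d where "d = (LEAST d. polyf d q)"
  have d: "polyf d q" "\<And>e. polyf e q \<Longrightarrow> d \<le> e"
    unfolding d_def using q(1) by (auto intro: LeastI Least_le)
  obtain h where h: "\<And>j. polyf j (h j)" "\<And>j s x. h j (s *s x) = s ^ j * h j x"
    "\<And>x. q x = (\<Sum>j\<le>d. h j x)" using polyf_homogeneous_components[OF d(1)] by metis
  have hp: "h d (p y) = h d y" for y
  proof -
    have "poly (\<Sum>j\<le>d. monom (h j (p y)) j) s = poly (\<Sum>j\<le>d. monom (h j y) j) s" for s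
      using q(2)[of "s *s y"] by (simp add: cprojD[OF p] h poly_sum poly_monom mult.commute)
    then have "(\<Sum>j\<le>d. monom (h j (p y)) j) = (\<Sum>j\<le>d. monom (h j y) j)"
      by (simp add: poly_eq_poly_eq_iff[symmetric] fun_eq_iff)
    from arg_cong[OF this, of "\<lambda>r. coeff r d"] show ?thesis by (simp add: coeff_sum)
  qed
  show False
  proof (cases d)
    case 0
    have "q y = h 0 0" for y using h(3)[of y] h(2)[of 0 0 y] 0 by simp
    then have "q = (\<lambda>_. h 0 0)" "h 0 0 \<noteq> 0" using x by auto
    then show False using const_top_nonvanishing[of "h 0 0" v] q(3) by simp
  next
    case (Suc e)
    have "\<exists>y. h d y \<noteq> 0"
    proof (rule ccontr)
      assume "\<not> ?thesis"
      then have "q = (\<lambda>x. \<Sum>j\<le>e. h j x)" using h(3) by (auto simp: Suc fun_eq_iff)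
      moreover have "polyf e (\<lambda>x. \<Sum>j\<le>e. h j x)"
        by (intro polyf_sum polyf.mono[OF h(1)]) auto
      ultimately show False using d(2)[of e] Suc by simp
    qed
    then obtain y where y: "h d y \<noteq> 0" ..
    have "h d 0 = 0" using h(2)[of d 0 0] Suc by simp
    then have "p y \<noteq> 0" using y hp[of y] by auto
    then obtain c a where c: "asymptotic_direction W c" "a \<noteq> 0" "p c = a *s p y" using surj by blast
    have "h d c = 0"
      by (rule top_component_vanishes[OF h(1,2) _ c(1)]) (use W h(3) in auto)
    moreover have "h d c = a ^ d * h d y" using hp[of c] hp[of y] c by (simp add: h(2))
    ultimately show False using y c by simp
  qed
qed

section \<open>Choice of a projection with maximal kernel\<close>

lemma cproj_reduce:
  assumes p: "cproj p" and m: "clinear_form m" "m w = 1" "p w = w"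
  shows "cproj (\<lambda>x. p x - m (p x) *s w)"
proof -
  have ml: "m (x + y) = m x + m y" "m (c *s x) = c * m x" "m (x - y) = m x - m y" for x y c
    using m(1) linear_diff[OF clinear_form_linear[OF m(1)]] by (auto simp: clinear_form_def)
  show ?thesis
    unfolding cproj_def clinear_map_def
    by (simp add: cprojD[OF p] ml m vec_eq_iff algebra_simps)
qed

text \<open>The last property is maximality in usable form: enlarging the kernel by
  \<open>p w\<close> must catch a nonzero direction c of \<open>W\<close>, and then
  \<open>p c\<close> is a nonzero multiple of \<open>p w\<close>. The search starts from the
  projection along \<open>v\<close>, whose kernel is the line of \<open>v\<close> and contains no
  nonzero direction because directions are closed under scaling.\<close>

lemma maximal_projection_exists:
  fixes v :: "complex ^ 'n::finite"
  assumes v: "v \<noteq> 0" and nv: "\<not> asymptotic_direction W v"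
  obtains p where "cproj p" "p v = 0" "\<And>c. asymptotic_direction W c \<Longrightarrow> p c = 0 \<Longrightarrow> c = 0"
    "\<And>w. p w \<noteq> 0 \<Longrightarrow> \<exists>c a. asymptotic_direction W c \<and> a \<noteq> 0 \<and> p c = a *s p w"
proof -
  have z: "cproj (\<lambda>_ :: complex ^ 'n. 0)" by (simp add: cproj_def clinear_map_def)
  let ?G = "\<lambda>p. cproj p \<and> p v = 0 \<and> (\<forall>c. asymptotic_direction W c \<longrightarrow> p c = 0 \<longrightarrow> c = 0)"
  obtain l where l: "clinear_form l" "l v = 1" using dual_form_exists[OF z _ v] by auto
  have G0: "?G (\<lambda>x. x - l x *s v)"
  proof (intro conjI allI impI)
    show "cproj (\<lambda>x. x - l x *s v)"
      using cproj_reduce[of "\<lambda>x. x" l v] l by (simp add: cproj_def clinear_map_def)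
    show "v - l v *s v = 0" using l by simp
    fix c assume c: "asymptotic_direction W c" "c - l c *s v = 0"
    show "c = 0"
    proof (rule ccontr)
      assume "c \<noteq> 0"
      then have "l c \<noteq> 0" using c by auto
      then have "v = inverse (l c) *s c" using c(2) by (simp add: vec_eq_iff field_simps)
      then show False using nv asymptotic_direction_scale[OF c(1)] by metis
    qed
  qed
  have "\<exists>p. ?G p \<and> (\<forall>q. ?G q \<longrightarrow> dim {x. q x = 0} \<le> dim {x. p x = 0})"
    by (rule Lattices_Big.ex_has_greatest_nat[of ?G, OF G0, where b = "Suc (DIM(complex ^ 'n))"])
      (intro allI impI le_imp_less_Suc dim_subset_UNIV)
  then obtain p where p: "?G p" and max: "\<And>q. ?G q \<Longrightarrow> dim {x. q x = 0} \<le> dim {x. p x = 0}"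
    by blast
  show ?thesis
  proof (rule that[of p])
    show "cproj p" "p v = 0" "\<And>c. asymptotic_direction W c \<Longrightarrow> p c = 0 \<Longrightarrow> c = 0" using p by auto
    fix w assume w: "p w \<noteq> 0"
    note pD = cprojD[OF conjunct1[OF p]]
    obtain m where m: "clinear_form m" "m (p w) = 1" using dual_form_exists[OF z _ w] by auto
    let ?q = "\<lambda>x. p x - m (p x) *s p w"
    have q: "cproj ?q" using cproj_reduce[of p m "p w"] p m pD by blast
    have "dim {x. p x = 0} < dim {x. ?q x = 0}"
      by (rule dim_kernel_less[OF q conjunct1[OF p], of w]) (use m w pD linear_0[OF clinear_form_linear[OF m(1)]] in auto)
    then have n: "\<not> dim {x. ?q x = 0} \<le> dim {x. p x = 0}" by simp
    have qv: "?q v = 0" using p linear_0[OF clinear_form_linear[OF m(1)]] by simp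
    have "\<exists>c. asymptotic_direction W c \<and> ?q c = 0 \<and> c \<noteq> 0"
    proof (rule ccontr)
      assume "\<not> ?thesis"
      then have "?G ?q" by (intro conjI q qv) blast
      then show False using max n by blast
    qed
    then obtain c where c: "asymptotic_direction W c" "?q c = 0" "c \<noteq> 0" by blast
    have "p c \<noteq> 0" using p c by blast
    then have "m (p c) \<noteq> 0" using c(2) by auto
    then show "\<exists>c a. asymptotic_direction W c \<and> a \<noteq> 0 \<and> p c = a *s p w"
      using c by (intro exI[of _ c] exI[of _ "m (p c)"]) auto
  qed
qed

section \<open>The two tangent cones\<close>

lemma asymptotic_direction_of_prime_ideal:
  fixes v :: "complex ^ 'n::finite"
  assumes P: "prime_ideal_of polyfuns P" and M: "P \<inter> top_nonvanishing v = {}" and v: "v \<noteq> 0"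
  shows "asymptotic_direction {x. \<forall>f\<in>P. f x = 0} v"
proof (rule ccontr)
  let ?W = "{x. \<forall>f\<in>P. f x = 0}"
  assume "\<not> asymptotic_direction ?W v"
  then obtain p where p: "cproj p" "p v = 0" "\<And>c. asymptotic_direction ?W c \<Longrightarrow> p c = 0 \<Longrightarrow> c = 0"
    "\<And>w. p w \<noteq> 0 \<Longrightarrow> \<exists>c a. asymptotic_direction ?W c \<and> a \<noteq> 0 \<and> p c = a *s p w"
    using maximal_projection_exists[OF v] by blast
  have pl: "clinear_map p" using p(1) by (simp add: cproj_def)
  obtain l where l: "clinear_form l" "l v = 1" "\<And>x. l (p x) = 0"
    using dual_form_exists[OF p(1,2) v] by blast
  interpret projection_extension P p l v
    using P p(1,2) l by unfold_locales
  obtain K where K: "0 \<le> K" "\<And>x. x \<in> ?W \<Longrightarrow> norm x \<le> K * (1 + norm (p x))"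
    using bounded_by_projection[OF pl p(3)] by blast
  obtain L where L: "0 < L" "\<And>x. norm (l x) \<le> L * norm x"
    using linear_bounded_pos[OF clinear_form_linear[OF l(1)]] by blast
  obtain J where J: "0 < J" "\<And>x. norm (p x) \<le> J * norm x"
    using linear_bounded_pos[OF clinear_map_linear[OF pl]] by blast
  \<comment> \<open>The image of \<open>?W\<close> under \<open>p\<close> is Zariski dense in the
    image of \<open>p\<close>, so every point there is a candidate for lifting.\<close>
  have zeros: "proj_zeros P p = {y. p y = y}"
  proof -
    have "f y = 0" if f: "f \<in> P" "f \<in> inv_ring p" for f y
    proof -
      obtain n where "polyf n f" using f by (auto simp: inv_ring_def polyfuns_def)
      moreover have "f (p x) = f x" for x using f(2) by (simp add: inv_ring_def)
      moreover have "f \<notin> top_nonvanishing v" using f(1) M by blast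
      moreover have "f x = 0" if "x \<in> ?W" for x using that f(1) by blast
      ultimately show ?thesis by (rule invariant_relation_trivial[OF p(1) _ _ _ _ p(4)])
    qed
    then show ?thesis by (auto simp: proj_zeros_def)
  qed
  have nonzero: "\<exists>x. f x \<noteq> 0" if "f \<notin> P" for f
  proof (rule ccontr)
    assume "\<not> ?thesis"
    then have "f = 0" by (simp add: fun_eq_iff)
    then show False using that Pcl(2) by simp
  qed
  obtain g where g: "g \<in> inv_ring p'" "g \<notin> P"
    "\<And>y. y \<in> proj_zeros P p' \<Longrightarrow> g y \<noteq> 0 \<Longrightarrow> \<exists>x. p' x = y \<and> (\<forall>f\<in>P. f x = 0)"
    using lift_generic[OF P cproj_p'] by blast
  \<comment> \<open>A pair (\<open>y\<close>, \<open>T\<close>) that lifts is (\<open>p x\<close>,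
    \<open>l x\<close>) for some \<open>x\<close> in \<open>?W\<close>, and \<open>norm x\<close> is
    controlled by \<open>norm y\<close>.\<close>
  have bound: "norm T \<le> L * K * (1 + norm y)"
    if y: "p y = y" and T: "y + T *s v \<in> proj_zeros P p' \<and> g (y + T *s v) \<noteq> 0" for y T
  proof -
    obtain x where x: "p' x = y + T *s v" "x \<in> ?W" using g(3) T by blast
    have "p x = y" "l x = T" using p_p'[of x] l_p'[of x] fibre[OF y, of T] x(1) by auto
    then have "norm T \<le> L * norm x" "norm x \<le> K * (1 + norm y)" using L(2)[of x] K(2)[OF x(2)] by auto
    then have "norm T \<le> L * (K * (1 + norm y))"
      using L(1) by (meson mult_left_mono less_imp_le order.trans)
    then show ?thesis by (simp add: mult.assoc)
  qed
  show False
  proof (cases "\<exists>F. relation_pol F")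
    \<comment> \<open>For transcendental \<open>l\<close>, all but finitely many \<open>T\<close>
      lift over one fixed point, against \<open>bound\<close>.\<close>
    case False
    obtain c where c: "c \<in> inv_ring p" "c \<notin> P"
      "\<And>y. y \<in> proj_zeros P p \<Longrightarrow> c y \<noteq> 0 \<Longrightarrow>
         finite {T. \<not> (y + T *s v \<in> proj_zeros P p' \<and> g (y + T *s v) \<noteq> 0)}"
      using lift_transcendental[OF False g(1,2)] by blast
    obtain x where x: "c x \<noteq> 0" using nonzero[OF c(2)] ..
    let ?B = "{T. \<not> (p x + T *s v \<in> proj_zeros P p' \<and> g (p x + T *s v) \<noteq> 0)}"
    have px: "p (p x) = p x" by (rule cprojD(3)[OF p(1)])
    have "c (p x) \<noteq> 0" using c(1) x by (simp add: inv_ring_def)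
    then have "finite ?B" using c(3)[of "p x"] px by (simp add: zeros)
    then have "bounded (?B \<union> cball 0 (L * K * (1 + norm (p x))))"
      by (simp add: finite_imp_bounded)
    moreover have "T \<in> ?B \<union> cball 0 (L * K * (1 + norm (p x)))" for T
    proof (cases "T \<in> ?B")
      case False
      then show ?thesis using bound[OF px, of T] by simp
    qed simp
    then have "?B \<union> cball 0 (L * K * (1 + norm (p x))) = UNIV" by blast
    ultimately have "bounded (UNIV :: complex set)" by (simp only:)
    then show False using not_bounded_UNIV by blast
  next
    case True
    then obtain F where F: "relation_pol F" ..
    have FS: "F \<in> polys_over (inv_ring p)" "poly F l \<in> P" "lead_coeff F \<notin> P"
      using F by (auto simp: relation_pol_def)
    obtain c where c: "c \<in> inv_ring p" "c \<notin> P"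
      "\<And>y. y \<in> proj_zeros P p \<Longrightarrow> c y \<noteq> 0 \<Longrightarrow> lead_coeff F y \<noteq> 0"
      "\<And>y T. y \<in> proj_zeros P p \<Longrightarrow> c y \<noteq> 0 \<Longrightarrow> poly (eval_coeffs y F) T = 0 \<Longrightarrow>
         y + T *s v \<in> proj_zeros P p' \<and> g (y + T *s v) \<noteq> 0"
      using lift_algebraic[OF F g(1,2)] by blast
    define d where "d = degree F"
    have Fi: "coeff F j (p x) = coeff F j x" and ci: "c (p x) = c x" for j x
      using FS c(1) by (auto simp: polys_over_def inv_ring_def)
    have Fpoly: "coeff F j \<in> polyfuns" for j using FS by (auto simp: polys_over_def inv_ring_def)
    have cpoly: "c \<in> polyfuns" using c(1) by (auto simp: inv_ring_def)
    \<comment> \<open>The factor \<open>1 + J\<close> turns growth in \<open>p x\<close> into growth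
      in \<open>x\<close>, the form required by \<open>polyf_divides_of_growth\<close>.\<close>
    define B where "B = L * K * (1 + J)"
    have B: "0 \<le> B" using K L J by (simp add: B_def)
    \<comment> \<open>The factor \<open>c x\<close> makes the estimate trivial where the roots of
      \<open>F\<close> are not known to lift; elsewhere it follows from the bound on the
      roots.\<close>
    have growth: "norm (c x * coeff F j x) \<le> 2 ^ d * B ^ (d - j) * (1 + norm x) ^ (d - j) * norm (c x * coeff F d x)"
      if j: "j \<le> d" for j x
    proof (cases "c x = 0")
      case False
      let ?y = "p x"
      have y: "?y \<in> proj_zeros P p" using cprojD(3)[OF p(1)] by (simp add: zeros)
      have cy: "c ?y \<noteq> 0" using False by (simp add: ci)
      have d: "degree (eval_coeffs ?y F) = d" using degree_eval_coeffs c(3)[OF y cy] by (simp add: d_def)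
      have "1 + norm (p x) \<le> (1 + J) * (1 + norm x)"
        using J norm_ge_zero[of x] by (simp add: algebra_simps add_increasing)
      then have "L * K * (1 + norm ?y) \<le> L * K * ((1 + J) * (1 + norm x))"
        using K L by (intro mult_left_mono) auto
      then have "norm T \<le> B * (1 + norm x)" if "poly (eval_coeffs ?y F) T = 0" for T
        using bound[OF cprojD(3)[OF p(1)] c(4)[OF y cy that]] by (simp add: B_def mult.assoc)
      then have "norm (coeff F j x) \<le> norm (coeff F d x) * 2 ^ d * (B * (1 + norm x)) ^ (d - j)"
        using coeff_bound_of_root_bound[of "eval_coeffs ?y F" "B * (1 + norm x)" j] B j
        by (simp add: d Fi)
      then have "norm (c x) * norm (coeff F j x) \<le>
          norm (c x) * (norm (coeff F d x) * 2 ^ d * (B * (1 + norm x)) ^ (d - j))"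
        by (rule mult_left_mono) simp
      then show ?thesis by (simp add: norm_mult power_mult_distrib mult_ac)
    qed simp
    have cF: "c * lead_coeff F \<in> polyfuns" "c * lead_coeff F \<notin> P"
      using subring_setD(4)[OF subring_polyfuns cpoly Fpoly] prime_P[OF cpoly Fpoly] c(2) FS(3) by blast+
    have "\<exists>q. polyf (d - j) q \<and> (\<forall>x. c x * coeff F j x = (c x * coeff F d x) * q x)" if j: "j \<le> d" for j
    proof -
      obtain m where m: "polyf m (\<lambda>x. c x * coeff F d x)"
        using cF(1) by (auto simp: polyfuns_def times_fun_def d_def)
      have "c * coeff F j \<in> polyfuns" by (rule subring_setD(4)[OF subring_polyfuns cpoly Fpoly])
      then obtain n where n: "polyf n (\<lambda>x. c x * coeff F j x)"
        by (auto simp: polyfuns_def times_fun_def)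
      obtain x0 where x0: "c x0 * coeff F d x0 \<noteq> 0" using nonzero[OF cF(2)] by (auto simp: d_def)
      show ?thesis
        using polyf_divides_of_growth[OF m n x0 _ growth[OF j]] B by (metis mult_nonneg_nonneg zero_le_numeral zero_le_power)
    qed
    then obtain q where q: "\<And>j. j \<le> d \<Longrightarrow> polyf (d - j) (q j)"
      "\<And>j x. j \<le> d \<Longrightarrow> c x * coeff F j x = (c x * coeff F d x) * q j x" by metis
    \<comment> \<open>The quotients are evaluated at \<open>p x\<close> because \<open>p\<close>
      kills the line of \<open>v\<close>: on it they reduce to the constants \<open>q j 0\<close>,
      and \<open>?f\<close> becomes monic of degree \<open>d\<close> in the parameter.\<close>
    let ?f = "\<lambda>x. (l x) ^ d + (\<Sum>j<d. q j (p x) * (l x) ^ j)"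
    have f: "polyf d ?f"
    proof (intro polyf.add polyf_sum)
      show "polyf d (\<lambda>x. l x ^ d)" using polyf_power[OF polyf_clinear_form[OF l(1)], of d] by simp
      fix j assume j: "j \<in> {..<d}"
      show "polyf d (\<lambda>x. q j (p x) * (l x) ^ j)"
        using polyf.mult[OF polyf_comp[OF q(1)[of j] pl] polyf_power[OF polyf_clinear_form[OF l(1)], of j]] j
        by simp
    qed
    \<comment> \<open>The division identities are used at \<open>p x\<close>; there \<open>c\<close>
      and the coefficients of \<open>F\<close> have the same values as at \<open>x\<close>.\<close>
    have "(c * lead_coeff F) * ?f = c * poly F l"
    proof
      fix x
      have s: "(\<Sum>j<d. (c x * coeff F d x) * q j (p x) * l x ^ j) = (\<Sum>j<d. c x * coeff F j x * l x ^ j)"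
      proof (rule sum.cong)
        fix j assume "j \<in> {..<d}"
        then have "c x * coeff F j x = (c x * coeff F d x) * q j (p x)"
          using q(2)[of j "p x", unfolded ci Fi] by simp
        then show "(c x * coeff F d x) * q j (p x) * l x ^ j = c x * coeff F j x * l x ^ j"
          by (simp only:)
      qed simp
      have "(c * lead_coeff F * ?f) x = (c x * coeff F d x) * ?f x" by (simp add: d_def)
      also have "\<dots> = (c x * coeff F d x) * l x ^ d + (\<Sum>j<d. (c x * coeff F d x) * q j (p x) * l x ^ j)"
        by (simp add: distrib_left sum_distrib_left mult.assoc)
      also have "\<dots> = (c x * coeff F d x) * l x ^ d + (\<Sum>j<d. c x * coeff F j x * l x ^ j)"
        by (simp only: s)
      also have "\<dots> = c x * (\<Sum>j\<le>d. coeff F j x * l x ^ j)"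
        by (simp add: sum_distrib_left mult.assoc distrib_left flip: lessThan_Suc_atMost)
      also have "(\<Sum>j\<le>d. coeff F j x * l x ^ j) = poly F l x"
        unfolding poly_fun_apply
        by (subst poly_eq_sum_coeff[of _ d]) (auto intro!: degree_le simp: d_def coeff_eq_0)
      finally show "(c * lead_coeff F * ?f) x = (c * poly F l) x" by simp
    qed
    then have "(c * lead_coeff F) * ?f \<in> P" using Pcl(4)[OF cpoly FS(2)] by simp
    then have "?f \<in> P" using prime_P[OF cF(1) polyfunsI[OF f]] cF(2) by blast
    moreover have "?f \<in> top_nonvanishing v"
    proof -
      let ?r = "monom 1 d + (\<Sum>j<d. monom (q j 0) j)"
      have r: "coeff ?r d = 1" by (simp add: coeff_sum)
      have "degree ?r \<le> d"
        by (intro degree_add_le degree_sum_le order.trans[OF degree_monom_le]) auto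
      then have "degree ?r = d" using r by (intro antisym le_degree) auto
      moreover have "?r \<noteq> 0" using r by (metis coeff_0 zero_neq_one)
      moreover have "?f (s *s v) = poly ?r s" for s
        using cprojD(2)[OF p(1), of s v] p(2) by (simp add: l_simps le poly_sum poly_monom)
      ultimately show ?thesis using f unfolding top_nonvanishing_def by blast
    qed
    ultimately show False using M by blast
  qed
qed

text \<open>A formal polynomial for \<open>g\<close> of total degree at most \<open>degree q\<close>
  must have exactly that degree, since \<open>q\<close> is its restriction to the line of
  \<open>v\<close>. The leading coefficient of \<open>q\<close> is then the value of its top form at
  \<open>v\<close>.\<close>

lemma vanishing_ideal_top_nonvanishing:
  assumes v: "v \<in> algebraic_cone_at_infinity V" and g: "\<And>x. x \<in> V \<Longrightarrow> g x = 0"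
  shows "g \<notin> top_nonvanishing v"
proof
  assume "g \<in> top_nonvanishing v"
  then obtain q where q: "polyf (degree q) g" "\<And>s. g (s *s v) = poly q s" "q \<noteq> 0"
    by (auto simp: top_nonvanishing_def)
  obtain f where f: "poly_value f = g" "total_degree f \<le> degree q"
    using polyf_representation[OF q(1)] .
  let ?h = "\<lambda>j. poly_value (hom_component j f) v"
  have "poly q s = poly (\<Sum>j\<le>total_degree f. monom (?h j) j) s" for s
    unfolding q(2)[symmetric] f(1)[symmetric] poly_value_eq_sum_hom_component[of f]
    by (simp add: poly_value_hom_component_scale poly_sum poly_monom mult.commute)
  then have "q = (\<Sum>j\<le>total_degree f. monom (?h j) j)"
    by (simp add: poly_eq_poly_eq_iff[symmetric] fun_eq_iff)
  from arg_cong[OF this, of "\<lambda>r. coeff r (degree q)"]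
  have "lead_coeff q = (if degree q \<le> total_degree f then ?h (degree q) else 0)"
    by (simp add: coeff_sum)
  then have "degree q = total_degree f" "?h (degree q) \<noteq> 0"
    using leading_coeff_neq_0[OF q(3)] f(2) by (metis le_antisym)+
  then have "poly_value (top_form f) v \<noteq> 0" by (simp add: top_form_def)
  moreover have "f \<in> vanishing_ideal V" using g f(1) by (auto simp: vanishing_ideal_def)
  ultimately show False using v by (auto simp: algebraic_cone_at_infinity_def)
qed

lemma algebraic_cone_subset_geometric_cone:
  fixes V :: "(complex ^ 'n::finite) set"
  assumes V: "algebraic_variety V"
  shows "algebraic_cone_at_infinity V \<subseteq> geometric_cone_at_infinity V"
proof
  fix v assume v: "v \<in> algebraic_cone_at_infinity V"
  let ?I = "{f \<in> polyfuns. \<forall>x\<in>V. f x = 0}"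
  have dis: "?I \<inter> top_nonvanishing v = {}"
    using vanishing_ideal_top_nonvanishing[OF v] by blast
  \<comment> \<open>For empty \<open>V\<close> the constant 1 lies in the vanishing ideal and its
    top form has no zeros, so both cones are empty. Nonemptiness also settles \<open>v = 0\<close>,
    by the convention.\<close>
  have "V \<noteq> {}"
    using const_top_nonvanishing[of 1 v] vanishing_ideal_top_nonvanishing[OF v, of "\<lambda>_. 1"] by auto
  moreover have "asymptotic_direction V v" if "v \<noteq> 0"
  proof -
    have "ideal_of polyfuns ?I"
      using subring_setD[OF subring_polyfuns] by (auto simp: ideal_of_def)
    moreover have "top_nonvanishing v \<subseteq> polyfuns"
      by (auto simp: top_nonvanishing_def intro: polyfunsI)
    moreover have "1 \<in> top_nonvanishing v"
      using const_top_nonvanishing[of 1 v] by (simp add: one_fun_def)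
    ultimately obtain P where P: "prime_ideal_of polyfuns P" "?I \<subseteq> P" "P \<inter> top_nonvanishing v = {}"
      using exists_prime_ideal_avoiding[OF subring_polyfuns, of ?I "top_nonvanishing v"]
        mult_top_nonvanishing dis by blast
    have "{x. \<forall>f\<in>P. f x = 0} \<subseteq> V"
    proof
      fix x assume x: "x \<in> {x. \<forall>f\<in>P. f x = 0}"
      obtain S where S: "V = {x. \<forall>f\<in>S. poly_value f x = 0}"
        using V by (auto simp: algebraic_variety_def)
      have "poly_value f \<in> ?I" if "f \<in> S" for f
        using that polyf_poly_value S by (auto intro: polyfunsI)
      then show "x \<in> V" using x P(2) S by blast
    qed
    then show ?thesis
      using asymptotic_direction_of_prime_ideal[OF P(1,3) that] unfolding asymptotic_direction_def by blast
  qed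
  ultimately show "v \<in> geometric_cone_at_infinity V"
    unfolding geometric_cone_at_infinity_def asymptotic_direction_def by blast
qed

lemma geometric_cone_subset_algebraic_cone:
  fixes V :: "(complex ^ 'n::finite) set"
  shows "geometric_cone_at_infinity V \<subseteq> algebraic_cone_at_infinity V"
proof
  fix v assume v: "v \<in> geometric_cone_at_infinity V"
  have "poly_value (top_form f) v = 0" if f: "f \<in> vanishing_ideal V" for f
  proof -
    let ?h = "\<lambda>j. poly_value (hom_component j f)"
    have z: "(\<Sum>j\<le>total_degree f. ?h j x) = 0" if "x \<in> V" for x
      using f that by (simp add: vanishing_ideal_def flip: poly_value_eq_sum_hom_component)
    show ?thesis
    proof (cases "asymptotic_direction V v")
      case True
      show ?thesis
        unfolding top_form_def
        by (rule top_component_vanishes[OF polyf_hom_component poly_value_hom_component_scale z True])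
    next
      \<comment> \<open>Here \<open>v = 0\<close> comes from the convention only. A constant in the
        ideal is zero because \<open>V\<close> has a point; a form of positive degree vanishes at
        the origin.\<close>
      case False
      then obtain x where x: "x \<in> V" "v = 0"
        using v unfolding geometric_cone_at_infinity_def asymptotic_direction_def by blast
      show ?thesis
      proof (cases "total_degree f")
        case 0
        have "?h 0 x = ?h 0 v"
          using poly_value_hom_component_scale[of 0 f 0 x] x(2) by simp
        then show ?thesis using z[OF x(1)] by (simp add: 0 top_form_def)
      next
        case (Suc n)
        then show ?thesis
          using poly_value_hom_component_scale[of "Suc n" f 0 0] x(2) by (simp add: top_form_def)
      qed
    qed
  qed
  then show "v \<in> algebraic_cone_at_infinity V" by (simp add: algebraic_cone_at_infinity_def)
qed

theorem theorem1p1: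
  fixes V :: "(complex ^ 'n::finite) set"
  assumes "algebraic_variety V"
  shows "algebraic_cone_at_infinity V = geometric_cone_at_infinity V"
  using algebraic_cone_subset_geometric_cone[OF assms] geometric_cone_subset_algebraic_cone by blast

end
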